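(* Let $\Gamma=(\mathsf{V},\mathsf{E})$ be a finite simplicial graph, and let $\mathfrak{g}$ be a Lie algebra. Then $\mathcal{F}(A^\bullet_\Gamma,\mathfrak{g})\supseteq\bigcup_{\mathsf{W}\subseteq\mathsf{V}}S_{\mathsf{W}}$. Moreover, if $\mathfrak{g}=\mathfrak{sl}_2$ or $\mathfrak{sol}_2$, then this inclusion holds as an equality, $$\mathcal{F}(A^\bullet_\Gamma,\mathfrak{g})=\bigcup_{\mathsf{W}\subseteq\mathsf{V}}S_{\mathsf{W}}.$$
   Context: Everything is over $\mathbb{C}$. $\mathfrak{sol}_2$ is the standard Borel subalgebra of $\mathfrak{sl}_2$. For a finite simplicial graph $\Gamma=(\mathsf{V},\mathsf{E})$, $A^\bullet_\Gamma=H^\bullet(\pi_\Gamma,\mathbb{C})$ is the cohomology algebra of the right-angled Artin group $\pi_\Gamma$ (generators $v\in\mathsf{V}$, relations $vw=wv$ for $\{v,w\}\in\mathsf{E}$), endowed with zero differential. It is the quotient of the exterior algebra on degree $1$ generators $v^*$, $v\in\mathsf{V}$, by the ideal generated by the monomials $v^*w^*$ with $\{v,w\}\notin\mathsf{E}$; thus $A^1_\Gamma=\mathbb{C}^{\mathsf{V}}$. For a commutative differential graded algebra $A$, $A\otimes\mathfrak{g}$ has bracket $[\alpha\otimes x,\beta\otimes y]=\alpha\beta\otimes[x,y]$ and differential $\partial(\alpha\otimes x)=d\alpha\otimes x$; the set of flat connections is $\mathcal{F}(A,\mathfrak{g})=\{\omega\in A^1\otimes\mathfrak{g}\mid\partial\omega+\frac12[\omega,\omega]=0\}$.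 Elements $\omega\in\mathbb{C}^{\mathsf{V}}\otimes\mathfrak{g}$ are written as tuples $(\omega_v)_{v\in\mathsf{V}}$ with $\omega_v\in\mathfrak{g}$. For $\mathsf{W}\subseteq\mathsf{V}$, let $\Gamma_{\mathsf{W}}$ be the induced subgraph, let $\mathsf{W}_1,\dots,\mathsf{W}_c$ be the vertex sets of its connected components, let $\overline{\mathsf{W}}=\mathsf{V}\setminus\mathsf{W}$, and put $$S_{\mathsf{W}}=\{\omega\in\mathbb{C}^{\mathsf{V}}\otimes\mathfrak{g}\mid\omega_v=0\text{ for }v\in\overline{\mathsf{W}},\ \operatorname{rank}\{\omega_v\}_{v\in\mathsf{W}_i}\le1\text{ for }1\le i\le c\},$$ where $\operatorname{rank}$ denotes the dimension of the linear span. *)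

theory Defs
  imports "Jordan_Normal_Form.VS_Connect" "HOL-Algebra.QuotRing" "HOL-Library.Poly_Mapping"
begin

section \<open>Complex vector spaces and Lie algebras\<close>

abbreviation complex_field :: "complex ring" where
  "complex_field \<equiv> class_ring"

abbreviation lin_span :: "(complex, 'a, 'm) module_scheme \<Rightarrow> 'a set \<Rightarrow> 'a set" where
  "lin_span M S \<equiv> LinearCombinations.module.span complex_field M S"

definition rank_of :: "(complex, 'a, 'm) module_scheme \<Rightarrow> 'a set \<Rightarrow> nat" where
  "rank_of M S = vectorspace.dim complex_field (M\<lparr>carrier := lin_span M S\<rparr>)"

text \<open>A Lie algebra is a vector space whose multiplication slot holds the bracket:
  \<open>x \<otimes>\<^bsub>L\<^esub> y\<close> is \<open>[x, y]\<close>. The slot for the unit is never used.\<close>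

locale lie_algebra = vectorspace "complex_field" L
  for L :: "(complex, 'a) module" (structure) +
  assumes bracket_closed:
      "\<lbrakk>x \<in> carrier L; y \<in> carrier L\<rbrakk> \<Longrightarrow> x \<otimes> y \<in> carrier L"
    and bracket_add_left:
      "\<lbrakk>x \<in> carrier L; y \<in> carrier L; z \<in> carrier L\<rbrakk> \<Longrightarrow> (x \<oplus> y) \<otimes> z = (x \<otimes> z) \<oplus> (y \<otimes> z)"
    and bracket_add_right:
      "\<lbrakk>x \<in> carrier L; y \<in> carrier L; z \<in> carrier L\<rbrakk> \<Longrightarrow> x \<otimes> (y \<oplus> z) = (x \<otimes> y) \<oplus> (x \<otimes> z)"
    and bracket_smult_left:
      "\<lbrakk>x \<in> carrier L; y \<in> carrier L\<rbrakk> \<Longrightarrow> (c \<odot> x) \<otimes> y = c \<odot> (x \<otimes> y)"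
    and bracket_smult_right:
      "\<lbrakk>x \<in> carrier L; y \<in> carrier L\<rbrakk> \<Longrightarrow> x \<otimes> (c \<odot> y) = c \<odot> (x \<otimes> y)"
    and bracket_alternating:
      "x \<in> carrier L \<Longrightarrow> x \<otimes> x = \<zero>"
    and jacobi:
      "\<lbrakk>x \<in> carrier L; y \<in> carrier L; z \<in> carrier L\<rbrakk> \<Longrightarrow>
        (x \<otimes> (y \<otimes> z)) \<oplus> (y \<otimes> (z \<otimes> x)) \<oplus> (z \<otimes> (x \<otimes> y)) = \<zero>"

definition sl2 :: "(complex, complex mat) module" where
  "sl2 = (module_mat TYPE(complex) 2 2)
    \<lparr>carrier := {X \<in> carrier_mat 2 2. (\<Sum>i<2. X $$ (i, i)) = 0},
     mult := (\<lambda>X Y. X * Y - Y * X)\<rparr>"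

definition sol2 :: "(complex, complex mat) module" where
  "sol2 = sl2\<lparr>carrier := {X \<in> carrier sl2. upper_triangular X}\<rparr>"


section \<open>Differential graded algebras, quotients and tensor products\<close>

text \<open>The same record holds commutative differential graded algebras and differential graded Lie
  algebras; for the latter the multiplication slot is the bracket.\<close>

record 'a dg_algebra = "(complex, 'a) module" +
  grade :: "nat \<Rightarrow> 'a set"
  differential :: "'a \<Rightarrow> 'a"

text \<open>The quotient by a graded two-sided ideal \<open>K\<close> that is stable under the differential. Elements
  are the cosets of \<open>K\<close>; the ring operations are those of \<open>Quot\<close>, and the remaining structure is
  defined on representatives.\<close>

definition dg_quotient :: "'a dg_algebra \<Rightarrow> 'a set \<Rightarrow> 'a set dg_algebra" where
  "dg_quotient M K =
    \<lparr>carrier = carrier (M Quot K),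
     mult = mult (M Quot K),
     one = one (M Quot K),
     zero = zero (M Quot K),
     add = add (M Quot K),
     smult = (\<lambda>c X. \<Union>x\<in>X. K +>\<^bsub>M\<^esub> (c \<odot>\<^bsub>M\<^esub> x)),
     grade = (\<lambda>i. (\<lambda>x. K +>\<^bsub>M\<^esub> x) ` grade M i),
     differential = (\<lambda>X. \<Union>x\<in>X. K +>\<^bsub>M\<^esub> differential M x)\<rparr>"

text \<open>The bilinear extension, to formal linear combinations, of an operation on basis elements.\<close>

definition bilinear_extension ::
    "('x \<Rightarrow> 'y \<Rightarrow> 'z) \<Rightarrow> ('x \<Rightarrow>\<^sub>0 complex) \<Rightarrow> ('y \<Rightarrow>\<^sub>0 complex) \<Rightarrow> ('z \<Rightarrow>\<^sub>0 complex)" where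
  "bilinear_extension f p q =
    (\<Sum>x\<in>Poly_Mapping.keys p. \<Sum>y\<in>Poly_Mapping.keys q.
      Poly_Mapping.single (f x y) (Poly_Mapping.lookup p x * Poly_Mapping.lookup q y))"

text \<open>Formal linear combinations of pairs \<open>(a, x)\<close>, to be read as \<open>a \<otimes> x\<close>, before the bilinearity
  relations are imposed. The unit slot is irrelevant.\<close>

definition formal_tensors ::
    "'a dg_algebra \<Rightarrow> (complex, 'g) module \<Rightarrow> ('a \<times> 'g \<Rightarrow>\<^sub>0 complex) dg_algebra" where
  "formal_tensors A L =
    \<lparr>carrier = {p. Poly_Mapping.keys p \<subseteq> carrier A \<times> carrier L},
     mult = bilinear_extension (\<lambda>(a, x) (b, y). (a \<otimes>\<^bsub>A\<^esub> b, x \<otimes>\<^bsub>L\<^esub> y)),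
     one = 0,
     zero = 0,
     add = (+),
     smult = (\<lambda>c. Poly_Mapping.map ((*) c)),
     grade = (\<lambda>i. {p. Poly_Mapping.keys p \<subseteq> grade A i \<times> carrier L}),
     differential = (\<lambda>p. \<Sum>(a, x)\<in>Poly_Mapping.keys p.
       Poly_Mapping.single (differential A a, x) (Poly_Mapping.lookup p (a, x)))\<rparr>"

definition tensor_relators ::
    "'a dg_algebra \<Rightarrow> (complex, 'g) module \<Rightarrow> ('a \<times> 'g \<Rightarrow>\<^sub>0 complex) set" where
  "tensor_relators A L =
    {Poly_Mapping.single (a \<oplus>\<^bsub>A\<^esub> b, x) 1 - Poly_Mapping.single (a, x) 1 - Poly_Mapping.single (b, x) 1
      | a b x. a \<in> carrier A \<and> b \<in> carrier A \<and> x \<in> carrier L} \<union>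
    {Poly_Mapping.single (a, x \<oplus>\<^bsub>L\<^esub> y) 1 - Poly_Mapping.single (a, x) 1 - Poly_Mapping.single (a, y) 1
      | a x y. a \<in> carrier A \<and> x \<in> carrier L \<and> y \<in> carrier L} \<union>
    {Poly_Mapping.single (c \<odot>\<^bsub>A\<^esub> a, x) 1 - Poly_Mapping.single (a, x) c
      | c a x. a \<in> carrier A \<and> x \<in> carrier L} \<union>
    {Poly_Mapping.single (a, c \<odot>\<^bsub>L\<^esub> x) 1 - Poly_Mapping.single (a, x) c
      | c a x. a \<in> carrier A \<and> x \<in> carrier L}"

abbreviation tensor_relations ::
    "'a dg_algebra \<Rightarrow> (complex, 'g) module \<Rightarrow> ('a \<times> 'g \<Rightarrow>\<^sub>0 complex) set" where
  "tensor_relations A L \<equiv> lin_span (formal_tensors A L) (tensor_relators A L)"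

definition tensor_lie ::
    "'a dg_algebra \<Rightarrow> (complex, 'g) module \<Rightarrow> ('a \<times> 'g \<Rightarrow>\<^sub>0 complex) set dg_algebra" where
  "tensor_lie A L = dg_quotient (formal_tensors A L) (tensor_relations A L)"

definition pure_tensor ::
    "'a dg_algebra \<Rightarrow> (complex, 'g) module \<Rightarrow> 'a \<Rightarrow> 'g \<Rightarrow> ('a \<times> 'g \<Rightarrow>\<^sub>0 complex) set" where
  "pure_tensor A L a x =
    tensor_relations A L +>\<^bsub>formal_tensors A L\<^esub> Poly_Mapping.single (a, x) 1"

definition flat_connections ::
    "'a dg_algebra \<Rightarrow> (complex, 'g) module \<Rightarrow> ('a \<times> 'g \<Rightarrow>\<^sub>0 complex) set set" where
  "flat_connections A L =
    {\<omega> \<in> grade (tensor_lie A L) 1.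
      differential (tensor_lie A L) \<omega> \<oplus>\<^bsub>tensor_lie A L\<^esub>
        ((1 / 2) \<odot>\<^bsub>tensor_lie A L\<^esub> (\<omega> \<otimes>\<^bsub>tensor_lie A L\<^esub> \<omega>)) = \<zero>\<^bsub>tensor_lie A L\<^esub>}"


section \<open>Graphs\<close>

definition simplicial_graph :: "'v set \<Rightarrow> 'v set set \<Rightarrow> bool" where
  "simplicial_graph V E \<longleftrightarrow> finite V \<and> (\<forall>e\<in>E. e \<subseteq> V \<and> card e = 2)"

definition induced_edges :: "'v set set \<Rightarrow> 'v set \<Rightarrow> 'v set set" where
  "induced_edges E W = {e \<in> E. e \<subseteq> W}"

definition connected_components :: "'v set \<Rightarrow> 'v set set \<Rightarrow> 'v set set" where
  "connected_components V E = V // {(u, v). {u, v} \<in> E}\<^sup>*"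


section \<open>The cohomology algebra of a right-angled Artin group\<close>

text \<open>The tensor algebra of \<open>\<complex>\<^sup>V\<close>, that is, the free associative algebra on \<open>V\<close>: formal linear
  combinations of words in \<open>V\<close>, graded by word length, with zero differential.\<close>

definition tensor_algebra :: "'v set \<Rightarrow> ('v list \<Rightarrow>\<^sub>0 complex) dg_algebra" where
  "tensor_algebra V =
    \<lparr>carrier = {p. Poly_Mapping.keys p \<subseteq> lists V},
     mult = bilinear_extension (@),
     one = Poly_Mapping.single [] 1,
     zero = 0,
     add = (+),
     smult = (\<lambda>c. Poly_Mapping.map ((*) c)),
     grade = (\<lambda>i. {p. Poly_Mapping.keys p \<subseteq> {w \<in> lists V. length w = i}}),
     differential = (\<lambda>_. 0)\<rparr>"

definition exterior_ideal :: "'v set \<Rightarrow> ('v list \<Rightarrow>\<^sub>0 complex) set" where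
  "exterior_ideal V =
    Idl\<^bsub>tensor_algebra V\<^esub> {x \<otimes>\<^bsub>tensor_algebra V\<^esub> x | x. x \<in> grade (tensor_algebra V) 1}"

definition exterior_algebra :: "'v set \<Rightarrow> ('v list \<Rightarrow>\<^sub>0 complex) set dg_algebra" where
  "exterior_algebra V = dg_quotient (tensor_algebra V) (exterior_ideal V)"

definition exterior_generator :: "'v set \<Rightarrow> 'v \<Rightarrow> ('v list \<Rightarrow>\<^sub>0 complex) set" where
  "exterior_generator V v =
    exterior_ideal V +>\<^bsub>tensor_algebra V\<^esub> Poly_Mapping.single [v] 1"

definition raag_ideal :: "'v set \<Rightarrow> 'v set set \<Rightarrow> ('v list \<Rightarrow>\<^sub>0 complex) set set" where
  "raag_ideal V E =
    Idl\<^bsub>exterior_algebra V\<^esub>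
      {exterior_generator V v \<otimes>\<^bsub>exterior_algebra V\<^esub> exterior_generator V w
        | v w. v \<in> V \<and> w \<in> V \<and> {v, w} \<notin> E}"

definition raag_cohomology ::
    "'v set \<Rightarrow> 'v set set \<Rightarrow> ('v list \<Rightarrow>\<^sub>0 complex) set set dg_algebra" where
  "raag_cohomology V E = dg_quotient (exterior_algebra V) (raag_ideal V E)"

definition raag_generator ::
    "'v set \<Rightarrow> 'v set set \<Rightarrow> 'v \<Rightarrow> ('v list \<Rightarrow>\<^sub>0 complex) set set" where
  "raag_generator V E v = raag_ideal V E +>\<^bsub>exterior_algebra V\<^esub> exterior_generator V v"


section \<open>The sets \<open>S\<^sub>W\<close>\<close>

text \<open>The tuple \<open>(\<omega>\<^sub>v)\<close> stands for the element \<open>\<Sum>\<^sub>v v\<^sup>* \<otimes> \<omega>\<^sub>v\<close> of \<open>A\<^sup>1 \<otimes> L\<close>;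
  \<open>S_tuples\<close> is \<open>S\<^sub>W\<close> as a set of tuples and \<open>S_set\<close> is its image in \<open>A\<^sup>1 \<otimes> L\<close>.\<close>

definition connection_of_tuple ::
    "'v set \<Rightarrow> 'v set set \<Rightarrow> (complex, 'g) module \<Rightarrow> ('v \<Rightarrow> 'g)
      \<Rightarrow> (('v list \<Rightarrow>\<^sub>0 complex) set set \<times> 'g \<Rightarrow>\<^sub>0 complex) set" where
  "connection_of_tuple V E L \<omega> =
    (\<Oplus>\<^bsub>tensor_lie (raag_cohomology V E) L\<^esub>v\<in>V.
      pure_tensor (raag_cohomology V E) L (raag_generator V E v) (\<omega> v))"

definition S_tuples ::
    "'v set \<Rightarrow> 'v set set \<Rightarrow> (complex, 'g) module \<Rightarrow> 'v set \<Rightarrow> ('v \<Rightarrow> 'g) set" where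
  "S_tuples V E L W =
    {\<omega> \<in> V \<rightarrow>\<^sub>E carrier L.
      (\<forall>v\<in>V - W. \<omega> v = \<zero>\<^bsub>L\<^esub>) \<and>
      (\<forall>C\<in>connected_components W (induced_edges E W). rank_of L (\<omega> ` C) \<le> 1)}"

definition S_set ::
    "'v set \<Rightarrow> 'v set set \<Rightarrow> (complex, 'g) module \<Rightarrow> 'v set
      \<Rightarrow> (('v list \<Rightarrow>\<^sub>0 complex) set set \<times> 'g \<Rightarrow>\<^sub>0 complex) set set" where
  "S_set V E L W = connection_of_tuple V E L ` S_tuples V E L W"

end

theory Submission
  imports Defs
begin

text \<open>Write a tensor of degree one as \<open>\<omega> = \<Sum>\<^sub>v v\<^sup>* \<otimes> \<omega>\<^sub>v\<close>. Since the differential of the cohomology algebra \<open>A\<close>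
  vanishes, \<open>\<omega>\<close> is flat if and only if \<open>[\<omega>, \<omega>] = \<Sum>\<^sub>v \<Sum>\<^sub>w v\<^sup>* w\<^sup>* \<otimes> [\<omega>\<^sub>v, \<omega>\<^sub>w]\<close> is zero. The products \<open>v\<^sup>* w\<^sup>*\<close> over
  non-edges vanish, while those over edges are independent apart from \<open>v\<^sup>* w\<^sup>* = - w\<^sup>* v\<^sup>*\<close>. Therefore, for
  every Lie algebra, \<open>\<omega>\<close> is flat if and only if \<open>[\<omega>\<^sub>v, \<omega>\<^sub>w] = 0\<close> along every edge. This is the lemma
  \<open>flat_connections_eq_commuting\<close>; what remains is linear algebra on the connected components.

  Elements on a common line commute, and adjacent vertices of \<open>W\<close> lie in the same component of the
  induced subgraph; this gives the inclusion for every Lie algebra (\<open>S_tuples_commuting\<close>). For the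
  converse let \<open>W\<close> be the set of vertices with \<open>\<omega>\<^sub>v \<noteq> 0\<close>. If the centralizer of each nonzero element is a
  line, then entries at adjacent vertices of \<open>W\<close> are proportional, and so are all entries on a component
  (\<open>commuting_in_S_tuples\<close>). In \<open>sl2\<close> the entries of the commutator of two matrices are, up to nonzero
  factors, the \<open>2 \<times> 2\<close> minors of their coordinate vectors, so commuting with a nonzero matrix means being a multiple of it; the
  subalgebra \<open>sol2\<close> inherits this.

  The algebra \<open>A\<close> is a quotient of a quotient of the tensor algebra, and \<open>A \<otimes> L\<close> is a quotient of formal
  combinations of pairs. Two facts are needed about this tower. First, every tensor of degree one comes
  from a tuple, because \<open>A\<close> is spanned in degree one by the generators (\<open>tuple_tensor_exists\<close>). Second,
  the bracket along an edge \<open>{v, w}\<close> can be read off from \<open>[\<omega>, \<omega>]\<close>. A single functional suffices, namely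
  the coefficient of the word \<open>vw\<close> minus that of \<open>wv\<close>: it respects the relations of \<open>A\<close>
  (\<open>edge_functional\<close>), and the contraction \<open>A \<otimes> L \<rightarrow> L\<close> along it sends \<open>[\<omega>, \<omega>]\<close> to \<open>2 [\<omega>\<^sub>v, \<omega>\<^sub>w]\<close>.\<close>

section \<open>Formal linear combinations\<close>

abbreviation scale :: "complex \<Rightarrow> ('k \<Rightarrow>\<^sub>0 complex) \<Rightarrow> ('k \<Rightarrow>\<^sub>0 complex)" where
  "scale c \<equiv> Poly_Mapping.map ((*) c)"

lemma lookup_scale [simp]: "Poly_Mapping.lookup (scale c p) k = c * Poly_Mapping.lookup p k"
  by (simp add: Poly_Mapping.map.rep_eq when_def)

lemma scale_single [simp]: "scale c (Poly_Mapping.single k d) = Poly_Mapping.single k (c * d)"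
  by (rule poly_mapping_eqI) (simp add: lookup_single when_def)

lemma scale_add: "scale c (p + q) = scale c p + scale c q"
  by (rule poly_mapping_eqI) (simp add: lookup_add algebra_simps)

lemma scale_diff: "scale c (p - q) = scale c p - scale c q"
  by (rule poly_mapping_eqI) (simp add: lookup_minus algebra_simps)

lemma scale_zero [simp]: "scale c 0 = 0"
  by (rule poly_mapping_eqI) simp

lemma scale_sum: "scale c (sum f I) = (\<Sum>i\<in>I. scale c (f i))"
  by (rule poly_mapping_eqI) (simp add: lookup_sum sum_distrib_left)

lemma keys_scale: "Poly_Mapping.keys (scale c p) \<subseteq> Poly_Mapping.keys p"
  by (auto simp: in_keys_iff)

lemma formal_sum:
  fixes p :: "'k \<Rightarrow>\<^sub>0 complex"
  assumes "finite X" "Poly_Mapping.keys p \<subseteq> X"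
  shows "p = (\<Sum>k\<in>X. Poly_Mapping.single k (Poly_Mapping.lookup p k))"
  using assms
  by (intro poly_mapping_eqI)
     (auto simp: lookup_sum lookup_single when_def sum.delta' in_keys_iff)

lemma formal_induct [consumes 1, case_names zero single add]:
  fixes p :: "'k \<Rightarrow>\<^sub>0 complex"
  assumes "Poly_Mapping.keys p \<subseteq> B"
    and "P 0"
    and "\<And>k c. k \<in> B \<Longrightarrow> P (Poly_Mapping.single k c)"
    and "\<And>p q. \<lbrakk>Poly_Mapping.keys p \<subseteq> B; Poly_Mapping.keys q \<subseteq> B; P p; P q\<rbrakk> \<Longrightarrow> P (p + q)"
  shows "P p"
proof -
  have "Poly_Mapping.keys (\<Sum>k\<in>X. Poly_Mapping.single k (Poly_Mapping.lookup p k)) \<subseteq> B \<and>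
      P (\<Sum>k\<in>X. Poly_Mapping.single k (Poly_Mapping.lookup p k))"
    if "finite X" "X \<subseteq> B" for X
    using that
  proof (induction X)
    case (insert x X)
    then show ?case
      using assms(3)[of x] by (auto intro!: assms(4) dest!: set_mp[OF keys_add] split: if_splits)
  qed (simp add: assms(2))
  from this[OF finite_keys assms(1)] show ?thesis
    using formal_sum[OF finite_keys order_refl, of p] by simp
qed

text \<open>The defining sum runs over the supports of the two arguments, so arguments with different supports
  cannot be compared directly. Summing over larger sets, where the extra terms vanish, removes the
  obstacle and yields bilinearity.\<close>

lemma bilinear_extension_eq_sum:
  assumes "finite X" "Poly_Mapping.keys p \<subseteq> X" "finite Y" "Poly_Mapping.keys q \<subseteq> Y"
  shows "bilinear_extension f p q =
    (\<Sum>x\<in>X. \<Sum>y\<in>Y. Poly_Mapping.single (f x y) (Poly_Mapping.lookup p x * Poly_Mapping.lookup q y))"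
  unfolding bilinear_extension_def using assms
  by (intro sum.mono_neutral_cong_left) (auto simp: in_keys_iff intro!: sum.mono_neutral_left)

lemma bilinear_extension_add_left:
  "bilinear_extension f (p + q) r = bilinear_extension f p r + bilinear_extension f q r"
proof -
  let ?X = "Poly_Mapping.keys p \<union> Poly_Mapping.keys q"
  have "bilinear_extension f s r = (\<Sum>x\<in>?X. \<Sum>y\<in>Poly_Mapping.keys r.
      Poly_Mapping.single (f x y) (Poly_Mapping.lookup s x * Poly_Mapping.lookup r y))"
    if "Poly_Mapping.keys s \<subseteq> ?X" for s
    using that by (intro bilinear_extension_eq_sum) auto
  then show ?thesis
    using keys_add[of p q]
    by (simp add: lookup_add algebra_simps single_add flip: sum.distrib)
qed

lemma bilinear_extension_add_right:
  "bilinear_extension f r (p + q) = bilinear_extension f r p + bilinear_extension f r q"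
proof -
  let ?X = "Poly_Mapping.keys p \<union> Poly_Mapping.keys q"
  have "bilinear_extension f r s = (\<Sum>x\<in>Poly_Mapping.keys r. \<Sum>y\<in>?X.
      Poly_Mapping.single (f x y) (Poly_Mapping.lookup r x * Poly_Mapping.lookup s y))"
    if "Poly_Mapping.keys s \<subseteq> ?X" for s
    using that by (intro bilinear_extension_eq_sum) auto
  then show ?thesis
    using keys_add[of p q]
    by (simp add: lookup_add algebra_simps single_add flip: sum.distrib)
qed

lemma bilinear_extension_diff_left:
  "bilinear_extension f (p - q) r = bilinear_extension f p r - bilinear_extension f q r"
  using bilinear_extension_add_left[of f "p - q" q r] by simp

lemma bilinear_extension_diff_right:
  "bilinear_extension f r (p - q) = bilinear_extension f r p - bilinear_extension f r q"
  using bilinear_extension_add_right[of f r "p - q" q] by simp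

lemma bilinear_extension_zero [simp]:
  "bilinear_extension f 0 q = 0" "bilinear_extension f p 0 = 0"
  by (simp_all add: bilinear_extension_def)

lemma bilinear_extension_single [simp]:
  "bilinear_extension f (Poly_Mapping.single x c) (Poly_Mapping.single y d) =
    Poly_Mapping.single (f x y) (c * d)"
  by (subst bilinear_extension_eq_sum[of "{x}" _ "{y}"]) auto

lemma bilinear_extension_scale_left:
  "bilinear_extension f (scale c p) q = scale c (bilinear_extension f p q)"
  by (subst bilinear_extension_eq_sum[of "Poly_Mapping.keys p" _ "Poly_Mapping.keys q"])
     (auto simp: bilinear_extension_def scale_sum mult.assoc dest!: set_mp[OF keys_scale])

lemma bilinear_extension_scale_right:
  "bilinear_extension f p (scale c q) = scale c (bilinear_extension f p q)"
  by (subst bilinear_extension_eq_sum[of "Poly_Mapping.keys p" _ "Poly_Mapping.keys q"])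
     (auto simp: bilinear_extension_def scale_sum algebra_simps dest!: set_mp[OF keys_scale])

lemma bilinear_extension_sum_left:
  "bilinear_extension f (sum g I) q = (\<Sum>i\<in>I. bilinear_extension f (g i) q)"
  by (induction I rule: infinite_finite_induct) (simp_all add: bilinear_extension_add_left)

lemma bilinear_extension_sum_right:
  "bilinear_extension f p (sum g I) = (\<Sum>i\<in>I. bilinear_extension f p (g i))"
  by (induction I rule: infinite_finite_induct) (simp_all add: bilinear_extension_add_right)

lemma keys_bilinear_extension:
  "Poly_Mapping.keys (bilinear_extension f p q) \<subseteq>
    (\<Union>x\<in>Poly_Mapping.keys p. f x ` Poly_Mapping.keys q)"
  unfolding bilinear_extension_def
  by (rule order_trans[OF keys_sum], rule UN_mono, simp, rule order_trans[OF keys_sum])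
     (auto split: if_splits)

lemma bilinear_extension_assoc:
  assumes "\<And>x y z. f (f x y) z = f x (f y z)"
  shows "bilinear_extension f (bilinear_extension f p q) r =
    bilinear_extension f p (bilinear_extension f q r)"
proof (induction p rule: formal_induct[OF subset_UNIV, case_names zero single add])
  case (single x c)
  show ?case
  proof (induction q rule: formal_induct[OF subset_UNIV, case_names zero single add])
    case (single y d)
    show ?case
      by (induction r rule: formal_induct[OF subset_UNIV, case_names zero single add])
        (simp_all add: assms mult.assoc bilinear_extension_add_right)
  qed (simp_all add: bilinear_extension_add_left bilinear_extension_add_right)
qed (simp_all add: bilinear_extension_add_left)

lemma bilinear_extension_unit:
  assumes "\<And>x. f e x = x" "\<And>x. f x e = x"
  shows "bilinear_extension f (Poly_Mapping.single e 1) p = p \<and>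
    bilinear_extension f p (Poly_Mapping.single e 1) = p"
  by (induction p rule: formal_induct[OF subset_UNIV, case_names zero single add])
    (simp_all add: assms bilinear_extension_add_left bilinear_extension_add_right)

text \<open>A word arises as a concatenation once for each place where it can be cut.\<close>

lemma lookup_concatenation_product:
  "Poly_Mapping.lookup (bilinear_extension (@) p q) u =
    (\<Sum>i\<le>length u. Poly_Mapping.lookup p (take i u) * Poly_Mapping.lookup q (drop i u))"
proof (induction p rule: formal_induct[OF subset_UNIV, case_names zero single add])
  case (single x c)
  show ?case
  proof (induction q rule: formal_induct[OF subset_UNIV, case_names zero single add])
    case (single y d)
    have "(\<Sum>i\<le>length u. Poly_Mapping.lookup (Poly_Mapping.single x c) (take i u) *
        Poly_Mapping.lookup (Poly_Mapping.single y d) (drop i u)) =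
      (\<Sum>i\<le>length u. if i = length x then (c * d when x @ y = u) else 0)"
    proof (rule sum.cong)
      fix i assume "i \<in> {..length u}"
      then have split: "x = take i u \<and> y = drop i u \<longleftrightarrow> i = length x \<and> x @ y = u"
        by (auto simp: append_eq_conv_conj)
      have "Poly_Mapping.lookup (Poly_Mapping.single x c) (take i u) *
          Poly_Mapping.lookup (Poly_Mapping.single y d) (drop i u) =
        (if x = take i u \<and> y = drop i u then c * d else 0)"
        by (simp add: lookup_single when_def)
      then show "Poly_Mapping.lookup (Poly_Mapping.single x c) (take i u) *
          Poly_Mapping.lookup (Poly_Mapping.single y d) (drop i u) =
        (if i = length x then (c * d when x @ y = u) else 0)"
        unfolding split by (simp add: when_def)
    qed simp
    also have "\<dots> = (c * d when x @ y = u)"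
      by (auto simp: when_def)
    finally show ?case
      by (simp add: lookup_single)
  qed (simp_all add: bilinear_extension_add_right lookup_add sum.distrib algebra_simps)
qed (simp_all add: bilinear_extension_add_left lookup_add sum.distrib algebra_simps)

section \<open>Algebras with a bilinear product and their quotients\<close>

text \<open>Associative algebras, Lie algebras and formal tensors share the quotient construction, which
  rests on the bilinearity of the product alone.\<close>

locale bilinear_algebra = Module.module "complex_field" M
  for M :: "(complex, 'a, 'm) module_scheme" (structure) +
  assumes mult_closed: "\<lbrakk>x \<in> carrier M; y \<in> carrier M\<rbrakk> \<Longrightarrow> x \<otimes> y \<in> carrier M"
    and mult_add_left:
      "\<lbrakk>x \<in> carrier M; y \<in> carrier M; z \<in> carrier M\<rbrakk> \<Longrightarrow> (x \<oplus> y) \<otimes> z = (x \<otimes> z) \<oplus> (y \<otimes> z)"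
    and mult_add_right:
      "\<lbrakk>x \<in> carrier M; y \<in> carrier M; z \<in> carrier M\<rbrakk> \<Longrightarrow> x \<otimes> (y \<oplus> z) = (x \<otimes> y) \<oplus> (x \<otimes> z)"
    and mult_smult_left:
      "\<lbrakk>x \<in> carrier M; y \<in> carrier M\<rbrakk> \<Longrightarrow> (c \<odot> x) \<otimes> y = c \<odot> (x \<otimes> y)"
    and mult_smult_right:
      "\<lbrakk>x \<in> carrier M; y \<in> carrier M\<rbrakk> \<Longrightarrow> x \<otimes> (c \<odot> y) = c \<odot> (x \<otimes> y)"
begin

lemma smult_carrier: "x \<in> carrier M \<Longrightarrow> c \<odot> x \<in> carrier M"
  by simp

lemma one_smult: "x \<in> carrier M \<Longrightarrow> 1 \<odot> x = x"
  using smult_one[of x] by simp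

lemma zero_smult: "x \<in> carrier M \<Longrightarrow> 0 \<odot> x = \<zero>"
  using smult_l_null[of x] by simp

lemma smult_zero: "c \<odot> \<zero> = \<zero>"
  using smult_r_null[of c] by simp

lemma mult_zero_right: "x \<in> carrier M \<Longrightarrow> x \<otimes> \<zero> = \<zero>"
  using mult_smult_right[of x \<zero> 0] zero_smult[of "\<zero>"] zero_smult[of "x \<otimes> \<zero>"] mult_closed[of x \<zero>]
  by simp

lemma mult_zero_left: "x \<in> carrier M \<Longrightarrow> \<zero> \<otimes> x = \<zero>"
  using mult_smult_left[of \<zero> x 0] zero_smult[of "\<zero>"] zero_smult[of "\<zero> \<otimes> x"] mult_closed[of \<zero> x]
  by simp

lemma uminus_eq_smult: "x \<in> carrier M \<Longrightarrow> \<ominus> x = (-1) \<odot> x"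
  using smult_l_minus[of 1 x] by (simp add: class_ring_simps one_smult)

end

lemma module_complexI:
  fixes M (structure)
  assumes "abelian_group M"
    and "\<And>c x. x \<in> carrier M \<Longrightarrow> c \<odot> x \<in> carrier M"
    and "\<And>c d x. x \<in> carrier M \<Longrightarrow> (c + d) \<odot> x = (c \<odot> x) \<oplus> (d \<odot> x)"
    and "\<And>c x y. \<lbrakk>x \<in> carrier M; y \<in> carrier M\<rbrakk> \<Longrightarrow> c \<odot> (x \<oplus> y) = (c \<odot> x) \<oplus> (c \<odot> y)"
    and "\<And>c d x. x \<in> carrier M \<Longrightarrow> (c * d) \<odot> x = c \<odot> (d \<odot> x)"
    and "\<And>x. x \<in> carrier M \<Longrightarrow> 1 \<odot> x = x"
  shows "Module.module complex_field M"
  using assms by (intro moduleI class_cring.cring_axioms) auto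

text \<open>Both the tensor algebra and the formal tensors are of this kind: the product of basis
  elements extends bilinearly to formal combinations of them.\<close>

lemma bilinear_algebra_formal:
  fixes M (structure)
  assumes M: "carrier M = {p. Poly_Mapping.keys p \<subseteq> B}" "\<zero> = 0" "add M = (+)"
      "module.smult M = scale" "mult M = bilinear_extension f"
    and f: "\<And>x y. \<lbrakk>x \<in> B; y \<in> B\<rbrakk> \<Longrightarrow> f x y \<in> B"
  shows "bilinear_algebra M"
proof -
  have ag: "abelian_group M"
  proof (rule abelian_groupI)
    fix x y assume "x \<in> carrier M" "y \<in> carrier M"
    then show "x \<oplus> y \<in> carrier M"
      using keys_add[of x y] by (auto simp: M)
  next
    fix x assume "x \<in> carrier M"
    then show "\<exists>y\<in>carrier M. y \<oplus> x = \<zero>"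
      by (intro bexI[of _ "- x"]) (auto simp: M)
  qed (auto simp: M algebra_simps)
  have mod: "Module.module complex_field M"
  proof (rule module_complexI[OF ag])
    fix c x assume "x \<in> carrier M"
    then show "c \<odot> x \<in> carrier M"
      using keys_scale[of c x] by (auto simp: M)
  qed (auto simp: M lookup_add algebra_simps intro!: poly_mapping_eqI)
  interpret Module.module complex_field M by (rule mod)
  show ?thesis
  proof unfold_locales
    fix x y assume "x \<in> carrier M" "y \<in> carrier M"
    then show "x \<otimes> y \<in> carrier M"
      using keys_bilinear_extension[of f x y] f by (fastforce simp: M)
  qed (auto simp: M bilinear_extension_add_left bilinear_extension_add_right
      bilinear_extension_scale_left bilinear_extension_scale_right)
qed

lemma submodule_complexI:
  assumes "Module.module complex_field M"
    and "N \<subseteq> carrier M" "\<zero>\<^bsub>M\<^esub> \<in> N"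
    and "\<And>x y. \<lbrakk>x \<in> N; y \<in> N\<rbrakk> \<Longrightarrow> x \<oplus>\<^bsub>M\<^esub> y \<in> N"
    and "\<And>c x. x \<in> N \<Longrightarrow> c \<odot>\<^bsub>M\<^esub> x \<in> N"
  shows "submodule complex_field N M"
  using assms by (simp add: submodule_def)

text \<open>The kernels by which such algebras may be divided. The lemmas below express every operation of
  the quotient through representatives.\<close>

locale algebra_ideal = bilinear_algebra M
  for M :: "'a dg_algebra" (structure) and K +
  assumes submodule_ideal: "submodule complex_field K M"
    and absorb_left: "\<lbrakk>x \<in> carrier M; k \<in> K\<rbrakk> \<Longrightarrow> x \<otimes> k \<in> K"
    and absorb_right: "\<lbrakk>x \<in> carrier M; k \<in> K\<rbrakk> \<Longrightarrow> k \<otimes> x \<in> K"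
begin

lemma ideal_carrier: "k \<in> K \<Longrightarrow> k \<in> carrier M"
  using submodule.subset[OF submodule_ideal] by blast

lemma ideal_zero: "\<zero> \<in> K"
  using submodule.zero_closed[OF submodule_ideal] .

lemma ideal_add: "\<lbrakk>x \<in> K; y \<in> K\<rbrakk> \<Longrightarrow> x \<oplus> y \<in> K"
  using submodule.m_closed[OF submodule_ideal] .

lemma ideal_smult: "x \<in> K \<Longrightarrow> c \<odot> x \<in> K"
  using submodule.smult_closed[OF submodule_ideal, of c x] by simp

lemma ideal_uminus: "x \<in> K \<Longrightarrow> \<ominus> x \<in> K"
  by (simp add: uminus_eq_smult ideal_carrier ideal_smult)

sublocale abelian_subgroup K M
proof (intro abelian_subgroupI3 additive_subgroupI)
  show "abelian_group M" ..
  show "subgroup K (add_monoid M)"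
    using ideal_uminus by unfold_locales (auto simp: ideal_carrier ideal_zero ideal_add a_inv_def)
qed

abbreviation coset where "coset x \<equiv> K +> x"
abbreviation quot where "quot \<equiv> dg_quotient M K"

lemma coset_eqI:
  assumes "k \<in> K" "x \<in> carrier M" "y = k \<oplus> x"
  shows "coset y = coset x"
  using assms a_repr_independence'[of y x] by (auto simp: a_r_coset_def')

lemma coset_elim:
  assumes "y \<in> coset x" "x \<in> carrier M"
  obtains k where "k \<in> K" "y = k \<oplus> x" "y \<in> carrier M" "coset y = coset x"
  using assms a_repr_independence'[of y x] ideal_carrier by (auto simp: a_r_coset_def')

lemma coset_eq_iff:
  assumes "x \<in> carrier M" "y \<in> carrier M"
  shows "coset x = coset y \<longleftrightarrow> x \<oplus> \<ominus> y \<in> K"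
  using assms a_rcos_module[of y x] a_repr_independence'[of x y] a_rcos_self[of x] by metis

lemma coset_ideal: "k \<in> K \<Longrightarrow> coset k = K"
  by (rule a_rcos_const)

lemma coset_eq_ideal_iff: "x \<in> carrier M \<Longrightarrow> coset x = K \<longleftrightarrow> x \<in> K"
  using a_rcos_self[of x] a_rcos_const by blast

lemma UN_const_coset:
  assumes "x \<in> carrier M" "\<And>y. y \<in> coset x \<Longrightarrow> f y = c"
  shows "(\<Union>y\<in>coset x. f y) = c"
  using assms a_rcos_self[of x] by auto

lemma quot_carrier: "carrier quot = coset ` carrier M"
  by (auto simp: dg_quotient_def FactRing_def A_RCOSETS_def')

lemma coset_carrier: "x \<in> carrier M \<Longrightarrow> coset x \<in> carrier quot"
  by (simp add: quot_carrier)

lemma quot_zero: "\<zero>\<^bsub>quot\<^esub> = K"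
  by (simp add: dg_quotient_def FactRing_def)

lemma quot_one: "\<one>\<^bsub>quot\<^esub> = coset \<one>"
  by (simp add: dg_quotient_def FactRing_def)

lemma quot_grade: "grade quot i = coset ` grade M i"
  by (simp add: dg_quotient_def)

lemma quot_add:
  assumes "x \<in> carrier M" "y \<in> carrier M"
  shows "coset x \<oplus>\<^bsub>quot\<^esub> coset y = coset (x \<oplus> y)"
  using assms a_rcos_sum by (simp add: dg_quotient_def FactRing_def)

lemma quot_mult:
  assumes "x \<in> carrier M" "y \<in> carrier M"
  shows "coset x \<otimes>\<^bsub>quot\<^esub> coset y = coset (x \<otimes> y)"
proof -
  have "coset (x' \<otimes> y') = coset (x \<otimes> y)" if x': "x' \<in> coset x" and y': "y' \<in> coset y" for x' y'
  proof -
    obtain k where k: "k \<in> K" "x' = k \<oplus> x" using coset_elim[OF x' assms(1)] by metis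
    obtain l where l: "l \<in> K" "y' = l \<oplus> y" using coset_elim[OF y' assms(2)] by metis
    have c: "k \<in> carrier M" "l \<in> carrier M" using k l ideal_carrier by auto
    have "x' \<otimes> y' = (k \<otimes> (l \<oplus> y) \<oplus> x \<otimes> l) \<oplus> x \<otimes> y"
      using k l c assms by (simp add: mult_add_left mult_add_right mult_closed M.a_ac)
    moreover have "k \<otimes> (l \<oplus> y) \<oplus> x \<otimes> l \<in> K"
      using k l c assms by (intro ideal_add absorb_left absorb_right) auto
    ultimately show ?thesis
      using assms by (intro coset_eqI) (auto simp: mult_closed)
  qed
  then have "(\<Union>x'\<in>coset x. \<Union>y'\<in>coset y. coset (x' \<otimes> y')) = coset (x \<otimes> y)"
    using assms by (intro UN_const_coset)
  then show ?thesis
    by (simp add: dg_quotient_def FactRing_def rcoset_mult_def)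
qed

lemma quot_smult:
  assumes "x \<in> carrier M"
  shows "c \<odot>\<^bsub>quot\<^esub> coset x = coset (c \<odot> x)"
proof -
  have "coset (c \<odot> x') = coset (c \<odot> x)" if x': "x' \<in> coset x" for x'
  proof -
    obtain k where k: "k \<in> K" "x' = k \<oplus> x" using coset_elim[OF x' assms] by metis
    have "c \<odot> x' = c \<odot> k \<oplus> c \<odot> x"
      using k assms ideal_carrier smult_r_distr[of c k x] by simp
    then show ?thesis
      using k assms ideal_smult by (intro coset_eqI) auto
  qed
  then have "(\<Union>x'\<in>coset x. coset (c \<odot> x')) = coset (c \<odot> x)"
    using assms by (intro UN_const_coset)
  then show ?thesis
    by (simp add: dg_quotient_def)
qed

lemma quot_differential:
  assumes "x \<in> carrier M" "\<And>y. y \<in> carrier M \<Longrightarrow> differential M y \<in> K"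
  shows "differential quot (coset x) = K"
  using assms
  by (auto simp: dg_quotient_def coset_ideal intro!: UN_const_coset elim: coset_elim)

lemma quot_abelian_group: "abelian_group quot"
proof (rule abelian_groupI)
  fix X assume "X \<in> carrier quot"
  then obtain x where x: "x \<in> carrier M" "X = coset x" by (auto simp: quot_carrier)
  then show "\<zero>\<^bsub>quot\<^esub> \<oplus>\<^bsub>quot\<^esub> X = X"
    using quot_add[of \<zero> x] coset_ideal[OF ideal_zero] by (simp add: quot_zero)
  show "\<exists>Y\<in>carrier quot. Y \<oplus>\<^bsub>quot\<^esub> X = \<zero>\<^bsub>quot\<^esub>"
    using x coset_ideal[OF ideal_zero]
    by (intro bexI[of _ "coset (\<ominus> x)"]) (auto simp: quot_add quot_zero M.l_neg coset_carrier)
qed (use coset_ideal[OF ideal_zero] in \<open>auto simp: quot_carrier quot_add quot_zero M.a_ac\<close>)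

lemma quot_bilinear_algebra: "bilinear_algebra quot"
proof -
  have "Module.module complex_field quot"
    using smult_l_distr smult_r_distr smult_assoc1
    by (intro module_complexI quot_abelian_group)
      (auto simp: quot_carrier quot_add quot_smult one_smult)
  then interpret Q: Module.module complex_field quot .
  show ?thesis
    by unfold_locales
      (auto simp: quot_carrier quot_add quot_smult quot_mult mult_closed mult_add_left
        mult_add_right mult_smult_left mult_smult_right)
qed

lemma quot_ring:
  assumes "ring M"
  shows "ring quot"
proof -
  interpret rng: ring M by fact
  have "Group.monoid quot"
    by (rule Group.monoidI) (auto simp: quot_carrier quot_mult quot_one rng.m_assoc)
  then show ?thesis
    by (intro ringI quot_abelian_group)
      (auto simp: quot_carrier quot_mult quot_add mult_closed rng.l_distr rng.r_distr)
qed

lemma quot_finsum: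
  assumes "finite I" "f \<in> I \<rightarrow> carrier M"
  shows "(\<Oplus>\<^bsub>quot\<^esub>i\<in>I. coset (f i)) = coset (\<Oplus>i\<in>I. f i)"
proof -
  interpret Q: abelian_group quot by (rule quot_abelian_group)
  show ?thesis
    using assms
  proof (induction I)
    case (insert i I)
    then show ?case
      by (auto simp: coset_carrier quot_add Pi_def)
  qed (simp add: quot_zero coset_ideal ideal_zero)
qed

end

text \<open>In a unital algebra the two-sided ideals of the underlying ring are automatically stable
  under scalars, since \<open>c \<odot> k = (c \<odot> \<one>) \<otimes> k\<close>; so ideals generated in the ring-theoretic sense
  are ideals of the algebra.\<close>

lemma ideal_imp_algebra_ideal:
  assumes "bilinear_algebra M" "ideal I M"
  shows "algebra_ideal M I"
proof -
  interpret bilinear_algebra M by fact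
  interpret I: ideal I M by fact
  have "c \<odot>\<^bsub>M\<^esub> k \<in> I" if "k \<in> I" for c k
    using that I.I_l_closed[of k "c \<odot>\<^bsub>M\<^esub> \<one>\<^bsub>M\<^esub>"] mult_smult_left[of "\<one>\<^bsub>M\<^esub>" k c] by simp
  then have "submodule complex_field I M"
    by (intro submodule_complexI module_axioms) (auto intro: I.zero_closed)
  then show ?thesis
    by (intro algebra_ideal.intro algebra_ideal_axioms.intro assms)
      (auto intro: I.I_l_closed I.I_r_closed)
qed

lemma algebra_ideal_imp_ideal:
  assumes "algebra_ideal M I" "ring M"
  shows "ideal I M"
proof -
  interpret I: algebra_ideal M I by fact
  show ?thesis
    by (intro idealI assms I.a_subgroup I.absorb_left I.absorb_right)
qed

lemma genideal_algebra_ideal: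
  assumes "bilinear_algebra M" "ring M" "S \<subseteq> carrier M"
  shows "algebra_ideal M (Idl\<^bsub>M\<^esub> S)"
  using assms by (intro ideal_imp_algebra_ideal ring.genideal_ideal)

section \<open>The tensor product\<close>

sublocale lie_algebra \<subseteq> bilinear_algebra L
  by unfold_locales
    (auto intro: bracket_closed bracket_add_left bracket_add_right bracket_smult_left bracket_smult_right)

text \<open>A graded algebra with zero differential and an algebra to be tensored with it. In the
  application these are a cohomology algebra and a Lie algebra.\<close>

locale tensor_factors = A: bilinear_algebra A + L: bilinear_algebra L
  for A :: "'a dg_algebra" and L :: "(complex, 'g) module" +
  assumes zero_differential: "a \<in> carrier A \<Longrightarrow> differential A a = \<zero>\<^bsub>A\<^esub>"
begin

abbreviation F where "F \<equiv> formal_tensors A L"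
abbreviation K where "K \<equiv> tensor_relations A L"

lemma F_simps:
  "carrier F = {p. Poly_Mapping.keys p \<subseteq> carrier A \<times> carrier L}" "\<zero>\<^bsub>F\<^esub> = 0" "add F = (+)"
  "module.smult F = scale"
  "mult F = bilinear_extension (\<lambda>(a, x) (b, y). (a \<otimes>\<^bsub>A\<^esub> b, x \<otimes>\<^bsub>L\<^esub> y))"
  by (simp_all add: formal_tensors_def)

sublocale F: bilinear_algebra F
  by (rule bilinear_algebra_formal[OF F_simps]) (auto simp: A.mult_closed L.mult_closed)

lemma single_carrier:
  "\<lbrakk>a \<in> carrier A; x \<in> carrier L\<rbrakk> \<Longrightarrow> Poly_Mapping.single (a, x) c \<in> carrier F"
  by (auto simp: F_simps)

lemma F_add_carrier: "\<lbrakk>p \<in> carrier F; q \<in> carrier F\<rbrakk> \<Longrightarrow> p + q \<in> carrier F"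
  using F.M.a_closed[of p q] by (simp add: F_simps(3))

lemma F_sum_carrier: "(\<And>i. i \<in> I \<Longrightarrow> f i \<in> carrier F) \<Longrightarrow> sum f I \<in> carrier F"
  using F.M.zero_closed
  by (induction I rule: infinite_finite_induct) (auto simp: F_add_carrier F_simps(2))

lemma F_scale_carrier: "p \<in> carrier F \<Longrightarrow> scale c p \<in> carrier F"
  using F.smult_carrier[of p c] by (simp add: F_simps(4))

lemma F_uminus_carrier: "p \<in> carrier F \<Longrightarrow> - p \<in> carrier F"
  by (simp add: F_simps(1))

lemma F_diff_carrier: "\<lbrakk>p \<in> carrier F; q \<in> carrier F\<rbrakk> \<Longrightarrow> p - q \<in> carrier F"
  using F_add_carrier[of p "- q"] F_uminus_carrier[of q] by simp

lemma relators_carrier: "tensor_relators A L \<subseteq> carrier F"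
  unfolding tensor_relators_def
  by (auto intro!: F_diff_carrier single_carrier A.smult_carrier L.smult_carrier
      A.M.a_closed L.M.a_closed)

lemma relations_submodule: "submodule complex_field K F"
  using relators_carrier by (rule F.span_is_submodule)

lemma relators_relations: "r \<in> tensor_relators A L \<Longrightarrow> r \<in> K"
  using F.in_own_span[OF relators_carrier] by blast

lemma K_closed:
  "0 \<in> K" "\<lbrakk>p \<in> K; q \<in> K\<rbrakk> \<Longrightarrow> p + q \<in> K" "p \<in> K \<Longrightarrow> scale c p \<in> K"
  using submodule.zero_closed[OF relations_submodule] submodule.m_closed[OF relations_submodule]
    submodule.smult_closed[OF relations_submodule]
  by (auto simp: F_simps)

lemma K_sum: "(\<And>i. i \<in> I \<Longrightarrow> f i \<in> K) \<Longrightarrow> sum f I \<in> K"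
  by (induction I rule: infinite_finite_induct) (auto simp: K_closed)

lemma relations_induct [consumes 1, case_names carrier zero add scale relator]:
  assumes "p \<in> K"
    and "\<And>p. P p \<Longrightarrow> p \<in> carrier F"
    and "P 0"
    and "\<And>p q. \<lbrakk>P p; P q\<rbrakk> \<Longrightarrow> P (p + q)"
    and "\<And>c p. P p \<Longrightarrow> P (scale c p)"
    and "\<And>r. r \<in> tensor_relators A L \<Longrightarrow> P r"
  shows "P p"
proof -
  have "submodule complex_field {p. P p} F"
    using assms by (intro submodule_complexI F.module_axioms) (auto simp: F_simps)
  then have "K \<subseteq> {p. P p}"
    using assms(6) by (intro F.span_is_subset) auto
  with assms(1) show ?thesis by blast
qed

lemma relator_add_left:
  "\<lbrakk>a \<in> carrier A; b \<in> carrier A; x \<in> carrier L\<rbrakk> \<Longrightarrow>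
    Poly_Mapping.single (a \<oplus>\<^bsub>A\<^esub> b, x) 1 - Poly_Mapping.single (a, x) 1 - Poly_Mapping.single (b, x) 1
      \<in> tensor_relators A L"
  unfolding tensor_relators_def by blast

lemma relator_add_right:
  "\<lbrakk>a \<in> carrier A; x \<in> carrier L; y \<in> carrier L\<rbrakk> \<Longrightarrow>
    Poly_Mapping.single (a, x \<oplus>\<^bsub>L\<^esub> y) 1 - Poly_Mapping.single (a, x) 1 - Poly_Mapping.single (a, y) 1
      \<in> tensor_relators A L"
  unfolding tensor_relators_def by blast

lemma relator_smult_left:
  "\<lbrakk>a \<in> carrier A; x \<in> carrier L\<rbrakk> \<Longrightarrow>
    Poly_Mapping.single (c \<odot>\<^bsub>A\<^esub> a, x) 1 - Poly_Mapping.single (a, x) c \<in> tensor_relators A L"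
  unfolding tensor_relators_def by blast

lemma relator_smult_right:
  "\<lbrakk>a \<in> carrier A; x \<in> carrier L\<rbrakk> \<Longrightarrow>
    Poly_Mapping.single (a, c \<odot>\<^bsub>L\<^esub> x) 1 - Poly_Mapping.single (a, x) c \<in> tensor_relators A L"
  unfolding tensor_relators_def by blast

lemma relator_cases [consumes 1, case_names add_left add_right smult_left smult_right]:
  assumes "r \<in> tensor_relators A L"
    and "\<And>a b x. \<lbrakk>a \<in> carrier A; b \<in> carrier A; x \<in> carrier L;
      r = Poly_Mapping.single (a \<oplus>\<^bsub>A\<^esub> b, x) 1 - Poly_Mapping.single (a, x) 1 - Poly_Mapping.single (b, x) 1\<rbrakk>
      \<Longrightarrow> P"
    and "\<And>a x y. \<lbrakk>a \<in> carrier A; x \<in> carrier L; y \<in> carrier L;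
      r = Poly_Mapping.single (a, x \<oplus>\<^bsub>L\<^esub> y) 1 - Poly_Mapping.single (a, x) 1 - Poly_Mapping.single (a, y) 1\<rbrakk>
      \<Longrightarrow> P"
    and "\<And>c a x. \<lbrakk>a \<in> carrier A; x \<in> carrier L;
      r = Poly_Mapping.single (c \<odot>\<^bsub>A\<^esub> a, x) 1 - Poly_Mapping.single (a, x) c\<rbrakk> \<Longrightarrow> P"
    and "\<And>c a x. \<lbrakk>a \<in> carrier A; x \<in> carrier L;
      r = Poly_Mapping.single (a, c \<odot>\<^bsub>L\<^esub> x) 1 - Poly_Mapping.single (a, x) c\<rbrakk> \<Longrightarrow> P"
  shows P
  using assms(1) unfolding tensor_relators_def
proof (elim UnE CollectE exE conjE)
qed (rule assms(2-5); assumption)+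

text \<open>Multiplying a relator by a multiple of a pure tensor gives a multiple of a relator of the same kind,
  because the products of both factors are bilinear. This is what makes the
  product of the tensor product well defined.\<close>

lemma relator_mult_single:
  assumes "r \<in> tensor_relators A L" "b \<in> carrier A" "y \<in> carrier L"
  shows "r \<otimes>\<^bsub>F\<^esub> Poly_Mapping.single (b, y) d \<in> K"
proof -
  note simps = F_simps(5) bilinear_extension_diff_left scale_diff mult.commute
  note closed = assms A.mult_closed L.mult_closed
  have "\<exists>s\<in>tensor_relators A L. r \<otimes>\<^bsub>F\<^esub> Poly_Mapping.single (b, y) d = scale d s"
    using assms(1)
  proof (cases rule: relator_cases)
    case (add_left a a' x)
    with closed show ?thesis
      by (intro bexI[OF _ relator_add_left[of "a \<otimes>\<^bsub>A\<^esub> b" "a' \<otimes>\<^bsub>A\<^esub> b" "x \<otimes>\<^bsub>L\<^esub> y"]])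
        (auto simp: simps A.mult_add_left)
  next
    case (add_right a x x')
    with closed show ?thesis
      by (intro bexI[OF _ relator_add_right[of "a \<otimes>\<^bsub>A\<^esub> b" "x \<otimes>\<^bsub>L\<^esub> y" "x' \<otimes>\<^bsub>L\<^esub> y"]])
        (auto simp: simps L.mult_add_left)
  next
    case (smult_left c a x)
    with closed show ?thesis
      by (intro bexI[OF _ relator_smult_left[of "a \<otimes>\<^bsub>A\<^esub> b" "x \<otimes>\<^bsub>L\<^esub> y" c]])
        (auto simp: simps A.mult_smult_left)
  next
    case (smult_right c a x)
    with closed show ?thesis
      by (intro bexI[OF _ relator_smult_right[of "a \<otimes>\<^bsub>A\<^esub> b" "x \<otimes>\<^bsub>L\<^esub> y" c]])
        (auto simp: simps L.mult_smult_left)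
  qed
  then show ?thesis
    using relators_relations K_closed(3) by auto
qed

lemma single_mult_relator:
  assumes "r \<in> tensor_relators A L" "b \<in> carrier A" "y \<in> carrier L"
  shows "Poly_Mapping.single (b, y) d \<otimes>\<^bsub>F\<^esub> r \<in> K"
proof -
  note simps = F_simps(5) bilinear_extension_diff_right scale_diff mult.commute
  note closed = assms A.mult_closed L.mult_closed
  have "\<exists>s\<in>tensor_relators A L. Poly_Mapping.single (b, y) d \<otimes>\<^bsub>F\<^esub> r = scale d s"
    using assms(1)
  proof (cases rule: relator_cases)
    case (add_left a a' x)
    with closed show ?thesis
      by (intro bexI[OF _ relator_add_left[of "b \<otimes>\<^bsub>A\<^esub> a" "b \<otimes>\<^bsub>A\<^esub> a'" "y \<otimes>\<^bsub>L\<^esub> x"]])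
        (auto simp: simps A.mult_add_right)
  next
    case (add_right a x x')
    with closed show ?thesis
      by (intro bexI[OF _ relator_add_right[of "b \<otimes>\<^bsub>A\<^esub> a" "y \<otimes>\<^bsub>L\<^esub> x" "y \<otimes>\<^bsub>L\<^esub> x'"]])
        (auto simp: simps L.mult_add_right)
  next
    case (smult_left c a x)
    with closed show ?thesis
      by (intro bexI[OF _ relator_smult_left[of "b \<otimes>\<^bsub>A\<^esub> a" "y \<otimes>\<^bsub>L\<^esub> x" c]])
        (auto simp: simps A.mult_smult_right)
  next
    case (smult_right c a x)
    with closed show ?thesis
      by (intro bexI[OF _ relator_smult_right[of "b \<otimes>\<^bsub>A\<^esub> a" "y \<otimes>\<^bsub>L\<^esub> x" c]])
        (auto simp: simps L.mult_smult_right)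
  qed
  then show ?thesis
    using relators_relations K_closed(3) by auto
qed

lemma relations_mult_right:
  assumes "p \<in> K" "q \<in> carrier F"
  shows "p \<otimes>\<^bsub>F\<^esub> q \<in> K"
proof -
  have rel: "r \<otimes>\<^bsub>F\<^esub> q \<in> K" if r: "r \<in> tensor_relators A L" for r
  proof -
    have "Poly_Mapping.keys q \<subseteq> carrier A \<times> carrier L"
      using assms(2) by (simp add: F_simps(1))
    then show ?thesis
    proof (induction q rule: formal_induct)
      case (single k c)
      then show ?case using relator_mult_single[OF r] by (cases k) auto
    next
      case (add p q)
      then show ?case by (simp add: F_simps(5) bilinear_extension_add_right K_closed)
    qed (simp add: F_simps(5) K_closed)
  qed
  have "p \<in> carrier F \<and> p \<otimes>\<^bsub>F\<^esub> q \<in> K"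
    using assms(1)
  proof (induction p rule: relations_induct)
    case zero
    then show ?case using F.M.zero_closed by (simp add: F_simps(2,5) K_closed)
  next
    case (add p q)
    then show ?case by (simp add: F_simps(5) bilinear_extension_add_left K_closed F_add_carrier)
  next
    case (scale c p)
    then show ?case by (simp add: F_simps(5) bilinear_extension_scale_left K_closed F_scale_carrier)
  next
    case (relator r)
    then show ?case using rel relators_carrier by auto
  qed auto
  then show ?thesis ..
qed

lemma relations_mult_left:
  assumes "p \<in> K" "q \<in> carrier F"
  shows "q \<otimes>\<^bsub>F\<^esub> p \<in> K"
proof -
  have rel: "q \<otimes>\<^bsub>F\<^esub> r \<in> K" if r: "r \<in> tensor_relators A L" for r
  proof -
    have "Poly_Mapping.keys q \<subseteq> carrier A \<times> carrier L"
      using assms(2) by (simp add: F_simps(1))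
    then show ?thesis
    proof (induction q rule: formal_induct)
      case (single k c)
      then show ?case using single_mult_relator[OF r] by (cases k) auto
    next
      case (add p q)
      then show ?case by (simp add: F_simps(5) bilinear_extension_add_left K_closed)
    qed (simp add: F_simps(5) K_closed)
  qed
  have "p \<in> carrier F \<and> q \<otimes>\<^bsub>F\<^esub> p \<in> K"
    using assms(1)
  proof (induction p rule: relations_induct)
    case zero
    then show ?case using F.M.zero_closed by (simp add: F_simps(2,5) K_closed)
  next
    case (add p q)
    then show ?case by (simp add: F_simps(5) bilinear_extension_add_right K_closed F_add_carrier)
  next
    case (scale c p)
    then show ?case by (simp add: F_simps(5) bilinear_extension_scale_right K_closed F_scale_carrier)
  next
    case (relator r)
    then show ?case using rel relators_carrier by auto
  qed auto
  then show ?thesis ..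
qed

sublocale T: algebra_ideal F K
  by (intro algebra_ideal.intro algebra_ideal_axioms.intro F.bilinear_algebra_axioms
      relations_submodule relations_mult_left relations_mult_right)

text \<open>A pure tensor with a zero factor is a relation, since \<open>0 = 0 \<odot> 0\<close>.\<close>

lemma relations_zero_left:
  assumes "x \<in> carrier L"
  shows "Poly_Mapping.single (\<zero>\<^bsub>A\<^esub>, x) c \<in> K"
  using K_closed(3)[OF relators_relations[OF relator_smult_left[of "\<zero>\<^bsub>A\<^esub>" x 0]], of c] assms
  by (simp add: A.smult_zero)

lemma relations_zero_right:
  assumes "a \<in> carrier A"
  shows "Poly_Mapping.single (a, \<zero>\<^bsub>L\<^esub>) c \<in> K"
  using K_closed(3)[OF relators_relations[OF relator_smult_right[of a "\<zero>\<^bsub>L\<^esub>" 0]], of c] assms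
  by (simp add: L.smult_zero)

lemma differential_relations:
  assumes "p \<in> carrier F"
  shows "differential F p \<in> K"
proof -
  have "differential F p = (\<Sum>(a, x)\<in>Poly_Mapping.keys p.
      Poly_Mapping.single (differential A a, x) (Poly_Mapping.lookup p (a, x)))"
    by (simp add: formal_tensors_def)
  also have "\<dots> \<in> K"
    using assms by (intro K_sum) (auto simp: F_simps(1) zero_differential relations_zero_left subset_iff)
  finally show ?thesis .
qed

text \<open>Since the differential of \<open>A\<close> vanishes, the Maurer-Cartan equation reduces to
  \<open>[\<omega>, \<omega>] = 0\<close>, that is, to a membership among the tensor relations.\<close>

lemma flat_connections_eq_cosets:
  assumes "grade A 1 \<subseteq> carrier A"
  shows "flat_connections A L =
    T.coset ` {p. Poly_Mapping.keys p \<subseteq> grade A 1 \<times> carrier L \<and> p \<otimes>\<^bsub>F\<^esub> p \<in> K}"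
proof -
  have "differential T.quot (T.coset p) \<oplus>\<^bsub>T.quot\<^esub>
      ((1 / 2) \<odot>\<^bsub>T.quot\<^esub> (T.coset p \<otimes>\<^bsub>T.quot\<^esub> T.coset p)) = \<zero>\<^bsub>T.quot\<^esub> \<longleftrightarrow> p \<otimes>\<^bsub>F\<^esub> p \<in> K"
    if p: "p \<in> carrier F" for p
  proof -
    have pp: "p \<otimes>\<^bsub>F\<^esub> p \<in> carrier F" by (rule F.mult_closed[OF p p])
    have "differential T.quot (T.coset p) = K"
      by (rule T.quot_differential[OF p]) (rule differential_relations)
    then have "differential T.quot (T.coset p) = T.coset \<zero>\<^bsub>F\<^esub>"
      by (simp only: T.coset_ideal[OF T.ideal_zero])
    then have "differential T.quot (T.coset p) \<oplus>\<^bsub>T.quot\<^esub>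
      ((1 / 2) \<odot>\<^bsub>T.quot\<^esub> (T.coset p \<otimes>\<^bsub>T.quot\<^esub> T.coset p)) = T.coset ((1 / 2) \<odot>\<^bsub>F\<^esub> (p \<otimes>\<^bsub>F\<^esub> p))"
      using p pp by (simp add: T.quot_mult T.quot_smult T.quot_add F.smult_carrier)
    then have "?thesis \<longleftrightarrow> ((1 / 2) \<odot>\<^bsub>F\<^esub> (p \<otimes>\<^bsub>F\<^esub> p) \<in> K \<longleftrightarrow> p \<otimes>\<^bsub>F\<^esub> p \<in> K)"
      using T.coset_eq_ideal_iff[OF F.smult_carrier[OF pp]] by (simp add: T.quot_zero)
    moreover have "p \<otimes>\<^bsub>F\<^esub> p = 2 \<odot>\<^bsub>F\<^esub> ((1 / 2) \<odot>\<^bsub>F\<^esub> (p \<otimes>\<^bsub>F\<^esub> p))"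
      by (rule poly_mapping_eqI) (simp add: F_simps(4))
    ultimately show ?thesis
      using T.ideal_smult by metis
  qed
  moreover have "grade F 1 = {p. Poly_Mapping.keys p \<subseteq> grade A 1 \<times> carrier L}"
    by (simp add: formal_tensors_def)
  moreover have "p \<in> carrier F" if "Poly_Mapping.keys p \<subseteq> grade A 1 \<times> carrier L" for p
    unfolding F_simps(1) by (intro CollectI order_trans[OF that] Sigma_mono assms order_refl)
  ultimately show ?thesis
    unfolding flat_connections_def tensor_lie_def T.quot_grade by auto
qed

subsection \<open>Contraction\<close>

text \<open>The map \<open>a \<otimes> x \<mapsto> \<psi>(a) x\<close> from \<open>A \<otimes> L\<close> to \<open>L\<close>, at the level of formal tensors. It serves to
  detect that a tensor is nonzero.\<close>

definition contraction :: "('a \<Rightarrow> complex) \<Rightarrow> ('a \<times> 'g \<Rightarrow>\<^sub>0 complex) \<Rightarrow> 'g" where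
  "contraction \<psi> p =
    (\<Oplus>\<^bsub>L\<^esub>k\<in>Poly_Mapping.keys p. (Poly_Mapping.lookup p k * \<psi> (fst k)) \<odot>\<^bsub>L\<^esub> snd k)"

lemma contraction_superset:
  assumes "finite X" "Poly_Mapping.keys p \<subseteq> X" "X \<subseteq> carrier A \<times> carrier L"
  shows "contraction \<psi> p = (\<Oplus>\<^bsub>L\<^esub>k\<in>X. (Poly_Mapping.lookup p k * \<psi> (fst k)) \<odot>\<^bsub>L\<^esub> snd k)"
  unfolding contraction_def using assms
  by (intro L.M.add.finprod_mono_neutral_cong_left)
    (auto simp: in_keys_iff L.zero_smult L.smult_carrier Pi_def dest!: set_mp)

lemma contraction_carrier:
  assumes "p \<in> carrier F"
  shows "contraction \<psi> p \<in> carrier L"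
  unfolding contraction_def using assms
  by (intro L.M.finsum_closed) (auto simp: F_simps(1) L.smult_carrier Pi_def dest!: set_mp)

lemma contraction_zero: "contraction \<psi> 0 = \<zero>\<^bsub>L\<^esub>"
  by (simp add: contraction_def)

lemma contraction_single:
  assumes "a \<in> carrier A" "x \<in> carrier L"
  shows "contraction \<psi> (Poly_Mapping.single (a, x) c) = (c * \<psi> a) \<odot>\<^bsub>L\<^esub> x"
  using assms
  by (subst contraction_superset[of "{(a, x)}"]) (auto simp: L.smult_carrier)

lemma contraction_add:
  assumes "p \<in> carrier F" "q \<in> carrier F"
  shows "contraction \<psi> (p + q) = contraction \<psi> p \<oplus>\<^bsub>L\<^esub> contraction \<psi> q"
proof -
  let ?X = "Poly_Mapping.keys p \<union> Poly_Mapping.keys q"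
  have X: "?X \<subseteq> carrier A \<times> carrier L" "finite ?X"
    using assms by (auto simp: F_simps(1))
  have c: "snd k \<in> carrier L" if "k \<in> ?X" for k
    using that X(1) by auto
  have "contraction \<psi> s = (\<Oplus>\<^bsub>L\<^esub>k\<in>?X. (Poly_Mapping.lookup s k * \<psi> (fst k)) \<odot>\<^bsub>L\<^esub> snd k)"
    if "Poly_Mapping.keys s \<subseteq> ?X" for s
    using that X by (intro contraction_superset)
  then have "contraction \<psi> (p + q) =
      (\<Oplus>\<^bsub>L\<^esub>k\<in>?X. (Poly_Mapping.lookup (p + q) k * \<psi> (fst k)) \<odot>\<^bsub>L\<^esub> snd k)"
    "contraction \<psi> p = (\<Oplus>\<^bsub>L\<^esub>k\<in>?X. (Poly_Mapping.lookup p k * \<psi> (fst k)) \<odot>\<^bsub>L\<^esub> snd k)"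
    "contraction \<psi> q = (\<Oplus>\<^bsub>L\<^esub>k\<in>?X. (Poly_Mapping.lookup q k * \<psi> (fst k)) \<odot>\<^bsub>L\<^esub> snd k)"
    using keys_add[of p q] by auto
  moreover have "(\<Oplus>\<^bsub>L\<^esub>k\<in>?X. (Poly_Mapping.lookup (p + q) k * \<psi> (fst k)) \<odot>\<^bsub>L\<^esub> snd k) =
    (\<Oplus>\<^bsub>L\<^esub>k\<in>?X. (Poly_Mapping.lookup p k * \<psi> (fst k)) \<odot>\<^bsub>L\<^esub> snd k \<oplus>\<^bsub>L\<^esub>
      (Poly_Mapping.lookup q k * \<psi> (fst k)) \<odot>\<^bsub>L\<^esub> snd k)"
    using c L.smult_l_distr
    by (intro L.M.finsum_cong') (auto simp: lookup_add distrib_right L.smult_carrier)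
  moreover have "\<dots> = (\<Oplus>\<^bsub>L\<^esub>k\<in>?X. (Poly_Mapping.lookup p k * \<psi> (fst k)) \<odot>\<^bsub>L\<^esub> snd k) \<oplus>\<^bsub>L\<^esub>
      (\<Oplus>\<^bsub>L\<^esub>k\<in>?X. (Poly_Mapping.lookup q k * \<psi> (fst k)) \<odot>\<^bsub>L\<^esub> snd k)"
    using c by (intro L.M.finsum_addf) (auto intro!: L.smult_carrier)
  ultimately show ?thesis
    by simp
qed

lemma contraction_scale:
  assumes "p \<in> carrier F"
  shows "contraction \<psi> (scale c p) = c \<odot>\<^bsub>L\<^esub> contraction \<psi> p"
proof -
  have "Poly_Mapping.keys p \<subseteq> carrier A \<times> carrier L"
    using assms by (simp add: F_simps(1))
  then show ?thesis
  proof (induction p rule: formal_induct)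
    case (single k d)
    then show ?case
      using L.smult_assoc1[of c "d * \<psi> (fst k)" "snd k"]
      by (cases k) (auto simp: contraction_single mult.assoc)
  next
    case (add p q)
    then have "p \<in> carrier F" "q \<in> carrier F" by (auto simp: F_simps(1))
    then show ?case
      using add L.smult_r_distr[of c "contraction \<psi> p" "contraction \<psi> q"]
      by (simp add: scale_add contraction_add F_scale_carrier contraction_carrier)
  qed (simp add: contraction_zero L.smult_zero)
qed

lemma contraction_sum:
  assumes "finite I" "\<And>i. i \<in> I \<Longrightarrow> f i \<in> carrier F"
  shows "contraction \<psi> (sum f I) = (\<Oplus>\<^bsub>L\<^esub>i\<in>I. contraction \<psi> (f i))"
  using assms
  by (induction I) (auto simp: contraction_zero contraction_add F_sum_carrier contraction_carrier)

text \<open>A linear functional \<open>\<psi>\<close> makes the contraction compatible with each of the four bilinearity relations,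
  so contraction descends to the tensor product.\<close>

lemma contraction_relations:
  assumes \<psi>: "\<And>a b. \<lbrakk>a \<in> carrier A; b \<in> carrier A\<rbrakk> \<Longrightarrow> \<psi> (a \<oplus>\<^bsub>A\<^esub> b) = \<psi> a + \<psi> b"
    "\<And>c a. a \<in> carrier A \<Longrightarrow> \<psi> (c \<odot>\<^bsub>A\<^esub> a) = c * \<psi> a"
    and p: "p \<in> K"
  shows "contraction \<psi> p = \<zero>\<^bsub>L\<^esub>"
proof -
  have diff: "contraction \<psi> (p - q) = \<zero>\<^bsub>L\<^esub>"
    if "p \<in> carrier F" "q \<in> carrier F" "contraction \<psi> p = contraction \<psi> q" for p q
    using contraction_add[of "p - q" q] that F_diff_carrier[of p q]
      contraction_carrier[of q] contraction_carrier[of "p - q"]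
    by simp
  have rel: "contraction \<psi> r = \<zero>\<^bsub>L\<^esub>" if "r \<in> tensor_relators A L" for r
    using that
  proof (cases rule: relator_cases)
    case (add_left a b x)
    then show ?thesis
      unfolding add_left diff_diff_eq using L.smult_l_distr[of "\<psi> a" "\<psi> b" x]
      by (intro diff F_add_carrier single_carrier)
        (auto simp: contraction_add contraction_single single_carrier \<psi>)
  next
    case (add_right a x y)
    then show ?thesis
      unfolding add_right diff_diff_eq using L.smult_r_distr[of "\<psi> a" x y]
      by (intro diff F_add_carrier single_carrier)
        (auto simp: contraction_add contraction_single single_carrier \<psi>)
  next
    case (smult_left c a x)
    then show ?thesis
      unfolding smult_left
      by (intro diff single_carrier) (auto simp: contraction_single A.smult_carrier \<psi>)
  next
    case (smult_right c a x)
    then show ?thesis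
      unfolding smult_right using L.smult_assoc1[of "\<psi> a" c x]
      by (intro diff single_carrier) (auto simp: contraction_single L.smult_carrier \<psi> mult.commute)
  qed
  have "p \<in> carrier F \<and> contraction \<psi> p = \<zero>\<^bsub>L\<^esub>"
    using p
  proof (induction p rule: relations_induct)
    case zero
    then show ?case using F.M.zero_closed by (simp add: F_simps(2) contraction_zero)
  next
    case (add p q)
    then show ?case by (simp add: contraction_add F_add_carrier)
  next
    case (scale c p)
    then show ?case by (simp add: contraction_scale F_scale_carrier L.smult_zero)
  next
    case (relator r)
    then show ?case using rel relators_carrier by auto
  qed auto
  then show ?thesis ..
qed

subsection \<open>Tuples\<close>

lemma coset_sum_cong:
  assumes "finite I" "\<And>i. i \<in> I \<Longrightarrow> f i \<in> carrier F" "\<And>i. i \<in> I \<Longrightarrow> h i \<in> carrier F"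
    "\<And>i. i \<in> I \<Longrightarrow> T.coset (f i) = T.coset (h i)"
  shows "T.coset (sum f I) = T.coset (sum h I)"
  using assms
proof (induction I)
  case (insert i I)
  have "T.coset (f i + sum f I) = T.coset (f i) \<oplus>\<^bsub>T.quot\<^esub> T.coset (sum f I)"
    using insert.prems(1,2) by (simp add: T.quot_add F_sum_carrier F_simps(3))
  also have "\<dots> = T.coset (h i) \<oplus>\<^bsub>T.quot\<^esub> T.coset (sum h I)"
    by (intro arg_cong2[of _ _ _ _ "add T.quot"] insert.IH insert.prems) auto
  also have "\<dots> = T.coset (h i + sum h I)"
    using insert.prems(1,2) by (simp add: T.quot_add F_sum_carrier F_simps(3))
  finally show ?case using insert.hyps by simp
qed simp

lemma coset_eq_if_diff: "\<lbrakk>p - q \<in> K; q \<in> carrier F\<rbrakk> \<Longrightarrow> T.coset p = T.coset q"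
  by (rule T.coset_eqI[of "p - q"]) (auto simp: F_simps(3))

lemma coset_add_left:
  assumes "a \<in> carrier A" "b \<in> carrier A" "x \<in> carrier L"
  shows "T.coset (Poly_Mapping.single (a \<oplus>\<^bsub>A\<^esub> b, x) 1) =
    T.coset (Poly_Mapping.single (a, x) 1 + Poly_Mapping.single (b, x) 1)"
  using assms
  by (intro coset_eq_if_diff F_add_carrier single_carrier
      relators_relations[OF relator_add_left, unfolded diff_diff_eq])

lemma coset_add_right:
  assumes "a \<in> carrier A" "x \<in> carrier L" "y \<in> carrier L"
  shows "T.coset (Poly_Mapping.single (a, x \<oplus>\<^bsub>L\<^esub> y) 1) =
    T.coset (Poly_Mapping.single (a, x) 1 + Poly_Mapping.single (a, y) 1)"
  using assms
  by (intro coset_eq_if_diff F_add_carrier single_carrier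
      relators_relations[OF relator_add_right, unfolded diff_diff_eq])

lemma coset_smult_left:
  assumes "a \<in> carrier A" "x \<in> carrier L"
  shows "T.coset (Poly_Mapping.single (c \<odot>\<^bsub>A\<^esub> a, x) 1) = T.coset (Poly_Mapping.single (a, x) c)"
  using assms
  by (intro coset_eq_if_diff single_carrier relators_relations[OF relator_smult_left])

lemma coset_smult_right:
  assumes "a \<in> carrier A" "x \<in> carrier L"
  shows "T.coset (Poly_Mapping.single (a, c \<odot>\<^bsub>L\<^esub> x) 1) = T.coset (Poly_Mapping.single (a, x) c)"
  using assms
  by (intro coset_eq_if_diff single_carrier relators_relations[OF relator_smult_right])

definition tuple_tensor :: "'v set \<Rightarrow> ('v \<Rightarrow> 'a) \<Rightarrow> ('v \<Rightarrow> 'g) \<Rightarrow> ('a \<times> 'g \<Rightarrow>\<^sub>0 complex)" where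
  "tuple_tensor V g \<omega> = (\<Sum>v\<in>V. Poly_Mapping.single (g v, \<omega> v) 1)"

lemma tuple_tensor_carrier:
  assumes "g \<in> V \<rightarrow> carrier A" "\<omega> \<in> V \<rightarrow> carrier L"
  shows "tuple_tensor V g \<omega> \<in> carrier F"
  unfolding tuple_tensor_def using assms by (intro F_sum_carrier single_carrier) auto

lemma finsum_pure_tensor:
  assumes "finite V" "g \<in> V \<rightarrow> carrier A" "\<omega> \<in> V \<rightarrow> carrier L"
  shows "(\<Oplus>\<^bsub>tensor_lie A L\<^esub>v\<in>V. pure_tensor A L (g v) (\<omega> v)) = T.coset (tuple_tensor V g \<omega>)"
proof -
  have "(\<Oplus>\<^bsub>F\<^esub>v\<in>V. Poly_Mapping.single (g v, \<omega> v) 1) = tuple_tensor V g \<omega>"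
    using assms unfolding tuple_tensor_def
    by (induction V) (auto simp: F_simps(2,3) single_carrier Pi_def)
  moreover have "(\<lambda>v. Poly_Mapping.single (g v, \<omega> v) 1) \<in> V \<rightarrow> carrier F"
    using assms by (auto intro!: single_carrier)
  ultimately show ?thesis
    using T.quot_finsum[OF assms(1), of "\<lambda>v. Poly_Mapping.single (g v, \<omega> v) 1"]
    by (simp add: tensor_lie_def pure_tensor_def)
qed

text \<open>If the degree one part of \<open>A\<close> is spanned by a finite family, then every tensor of degree one is
  given by a tuple of elements of \<open>L\<close>: collect the coefficients of each member of the family.\<close>

lemma tuple_tensor_exists:
  assumes V: "finite V" and g: "g \<in> V \<rightarrow> carrier A"
    and p: "Poly_Mapping.keys p \<subseteq> lin_span A (g ` V) \<times> carrier L"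
  shows "\<exists>\<omega>\<in>V \<rightarrow> carrier L. T.coset p = T.coset (tuple_tensor V g \<omega>)"
proof -
  define G where "G = {p \<in> carrier F. \<exists>\<omega>\<in>V \<rightarrow> carrier L. T.coset p = T.coset (tuple_tensor V g \<omega>)}"
  note tc = tuple_tensor_carrier[OF g]
  have gV: "g v \<in> carrier A" if "v \<in> V" for v using g that by auto
  have cong: "p \<in> G" if "q \<in> G" "T.coset p = T.coset q" "p \<in> carrier F" for p q
    using that by (auto simp: G_def)
  have zero: "0 \<in> G"
  proof -
    have "tuple_tensor V g (\<lambda>_. \<zero>\<^bsub>L\<^esub>) \<in> K"
      unfolding tuple_tensor_def by (intro K_sum relations_zero_right gV)
    then show ?thesis
      using T.coset_ideal K_closed(1) F.M.zero_closed unfolding G_def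
      by (auto simp: F_simps(2) intro!: bexI[of _ "\<lambda>_. \<zero>\<^bsub>L\<^esub>"])
  qed
  have add: "p + q \<in> G" if pq: "p \<in> G" "q \<in> G" for p q
  proof -
    obtain \<omega> \<omega>' where \<omega>: "\<omega> \<in> V \<rightarrow> carrier L" "T.coset p = T.coset (tuple_tensor V g \<omega>)"
      and \<omega>': "\<omega>' \<in> V \<rightarrow> carrier L" "T.coset q = T.coset (tuple_tensor V g \<omega>')"
      and c: "p \<in> carrier F" "q \<in> carrier F"
      using pq by (auto simp: G_def)
    have "T.coset (p + q) = T.coset (tuple_tensor V g \<omega> + tuple_tensor V g \<omega>')"
      using T.quot_add[OF c] T.quot_add[OF tc[OF \<omega>(1)] tc[OF \<omega>'(1)]] \<omega>(2) \<omega>'(2)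
      by (simp add: F_simps(3))
    also have "\<dots> = T.coset (tuple_tensor V g (\<lambda>v. \<omega> v \<oplus>\<^bsub>L\<^esub> \<omega>' v))"
      unfolding tuple_tensor_def sum.distrib[symmetric] using V \<omega> \<omega>' gV
      by (intro coset_sum_cong F_add_carrier single_carrier coset_add_right[symmetric])
        (auto simp: Pi_iff)
    finally show ?thesis
      using c \<omega> \<omega>' unfolding G_def
      by (auto simp: F_add_carrier intro!: bexI[of _ "\<lambda>v. \<omega> v \<oplus>\<^bsub>L\<^esub> \<omega>' v"])
  qed
  have scale: "scale d p \<in> G" if p: "p \<in> G" for d p
  proof -
    obtain \<omega> where \<omega>: "\<omega> \<in> V \<rightarrow> carrier L" "T.coset p = T.coset (tuple_tensor V g \<omega>)"
      and c: "p \<in> carrier F"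
      using p by (auto simp: G_def)
    have "T.coset (scale d p) = T.coset (scale d (tuple_tensor V g \<omega>))"
      using T.quot_smult[OF c, of d] T.quot_smult[OF tc[OF \<omega>(1)], of d] \<omega>(2)
      by (simp add: F_simps(4))
    also have "\<dots> = T.coset (tuple_tensor V g (\<lambda>v. d \<odot>\<^bsub>L\<^esub> \<omega> v))"
      unfolding tuple_tensor_def scale_sum scale_single mult_1_right using V \<omega> gV
      by (intro coset_sum_cong single_carrier coset_smult_right[symmetric] L.smult_carrier)
        (auto simp: Pi_iff)
    finally show ?thesis
      using c \<omega> unfolding G_def
      by (auto simp: F_scale_carrier L.smult_carrier intro!: bexI[of _ "\<lambda>v. d \<odot>\<^bsub>L\<^esub> \<omega> v"])
  qed
  define N where "N = {a \<in> carrier A. \<forall>x\<in>carrier L. Poly_Mapping.single (a, x) 1 \<in> G}"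
  have gN: "g ` V \<subseteq> N"
  proof (clarsimp simp: N_def gV)
    fix v x assume v: "v \<in> V" and x: "x \<in> carrier L"
    let ?\<omega> = "\<lambda>u. if u = v then x else \<zero>\<^bsub>L\<^esub>"
    have "T.coset (\<Sum>u\<in>V. if u = v then Poly_Mapping.single (g v, x) 1 else 0) = T.coset (tuple_tensor V g ?\<omega>)"
      unfolding tuple_tensor_def using V v x gV F.M.zero_closed T.coset_ideal K_closed(1)
      by (intro coset_sum_cong) (auto simp: F_simps(2) relations_zero_right intro!: single_carrier)
    then show "Poly_Mapping.single (g v, x) 1 \<in> G"
      using V v x gV unfolding G_def by (auto simp: single_carrier intro!: bexI[of _ ?\<omega>])
  qed
  have "submodule complex_field N A"
  proof (rule submodule_complexI[OF A.module_axioms])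
    show "\<zero>\<^bsub>A\<^esub> \<in> N"
      using zero T.coset_ideal K_closed(1) unfolding N_def
      by (auto intro!: cong[OF zero] single_carrier simp: relations_zero_left)
    fix a b assume ab: "a \<in> N" "b \<in> N"
    then show "a \<oplus>\<^bsub>A\<^esub> b \<in> N"
      unfolding N_def by (auto intro!: cong[OF add coset_add_left] single_carrier)
  next
    fix d a assume a: "a \<in> N"
    have "Poly_Mapping.single (a, x) d \<in> G" if "x \<in> carrier L" for x
      using scale[of "Poly_Mapping.single (a, x) 1" d] a that by (simp add: N_def)
    then show "d \<odot>\<^bsub>A\<^esub> a \<in> N"
      using a unfolding N_def
      by (auto intro!: cong[OF _ coset_smult_left] single_carrier A.smult_carrier)
  qed (auto simp: N_def)
  then have span: "lin_span A (g ` V) \<subseteq> N"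
    using gN by (intro A.span_is_subset)
  have "p \<in> G"
    using p
  proof (induction p rule: formal_induct)
    case (single k c)
    obtain a x where k: "k = (a, x)" by (cases k)
    with single span have "Poly_Mapping.single (a, x) 1 \<in> G" by (auto simp: N_def)
    from scale[OF this, of c] show ?case by (simp add: k)
  qed (auto intro: zero add)
  then show ?thesis by (simp add: G_def)
qed

lemma tuple_tensor_mult:
  "tuple_tensor V g \<omega> \<otimes>\<^bsub>F\<^esub> tuple_tensor V g \<omega> =
    (\<Sum>v\<in>V. \<Sum>w\<in>V. Poly_Mapping.single (g v \<otimes>\<^bsub>A\<^esub> g w, \<omega> v \<otimes>\<^bsub>L\<^esub> \<omega> w) 1)"
  unfolding tuple_tensor_def F_simps(5)
  by (subst bilinear_extension_sum_left, subst bilinear_extension_sum_right) simp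

end

section \<open>The cohomology algebra of a right-angled Artin group\<close>

text \<open>From here on \<open>T\<close>, \<open>Ext\<close> and \<open>A\<close> are the tensor algebra, the exterior algebra and the cohomology
  algebra. The ideals in their definitions are intersections of all ring-theoretic ideals containing the
  relations, so rings are needed at the first two stages.\<close>

locale raag =
  fixes V :: "'v set" and E :: "'v set set"
  assumes graph: "simplicial_graph V E"
begin

lemma finite_vertices: "finite V"
  using graph by (simp add: simplicial_graph_def)

lemma edge_vertices: "{v, w} \<in> E \<Longrightarrow> v \<in> V" "{v, w} \<in> E \<Longrightarrow> w \<in> V"
  using graph by (auto simp: simplicial_graph_def)

lemma edge_distinct: "{v, w} \<in> E \<Longrightarrow> v \<noteq> w"
  using graph by (auto simp: simplicial_graph_def)

abbreviation T where "T \<equiv> tensor_algebra V"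

lemma T_simps:
  "carrier T = {p. Poly_Mapping.keys p \<subseteq> lists V}" "\<zero>\<^bsub>T\<^esub> = 0" "add T = (+)"
  "module.smult T = scale" "mult T = bilinear_extension (@)" "\<one>\<^bsub>T\<^esub> = Poly_Mapping.single [] 1"
  "grade T i = {p. Poly_Mapping.keys p \<subseteq> {w \<in> lists V. length w = i}}" "differential T x = 0"
  by (simp_all add: tensor_algebra_def)

sublocale T: bilinear_algebra T
  by (rule bilinear_algebra_formal[OF T_simps(1-5)]) auto

lemma ring_T: "ring T"
proof (rule ringI)
  show "abelian_group T" by (rule T.M.abelian_group_axioms)
  show "Group.monoid T"
    by (rule Group.monoidI, rule T.mult_closed)
      (auto simp: T_simps bilinear_extension_assoc bilinear_extension_unit)
qed (auto intro: T.mult_add_left T.mult_add_right)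

lemma word_carrier: "set u \<subseteq> V \<Longrightarrow> Poly_Mapping.single u c \<in> carrier T"
  by (auto simp: T_simps)

lemma grade_T_carrier: "x \<in> grade T i \<Longrightarrow> x \<in> carrier T"
  by (auto simp: T_simps)

lemma ext_relations_carrier: "{x \<otimes>\<^bsub>T\<^esub> x | x. x \<in> grade T 1} \<subseteq> carrier T"
  using T.mult_closed grade_T_carrier by blast

sublocale X: algebra_ideal T "exterior_ideal V"
  unfolding exterior_ideal_def
  by (rule genideal_algebra_ideal[OF T.bilinear_algebra_axioms ring_T ext_relations_carrier])

abbreviation Ext where "Ext \<equiv> exterior_algebra V"

lemma Ext_eq: "Ext = X.quot"
  by (simp add: exterior_algebra_def)

lemma ring_Ext: "ring Ext"
  unfolding Ext_eq by (rule X.quot_ring[OF ring_T])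

lemma bilinear_Ext: "bilinear_algebra Ext"
  unfolding Ext_eq by (rule X.quot_bilinear_algebra)

lemma exterior_generator_eq: "exterior_generator V v = X.coset (Poly_Mapping.single [v] 1)"
  by (simp add: exterior_generator_def)

lemma exterior_generator_mult:
  assumes "v \<in> V" "w \<in> V"
  shows "exterior_generator V v \<otimes>\<^bsub>Ext\<^esub> exterior_generator V w = X.coset (Poly_Mapping.single [v, w] 1)"
  using assms X.quot_mult[of "Poly_Mapping.single [v] 1" "Poly_Mapping.single [w] 1"]
  by (simp add: exterior_generator_eq Ext_eq word_carrier) (simp add: T_simps)

lemma X_coset_carrier: "t \<in> carrier T \<Longrightarrow> X.coset t \<in> carrier Ext"
  by (simp add: Ext_eq X.coset_carrier)

abbreviation raag_relations where
  "raag_relations \<equiv> {exterior_generator V v \<otimes>\<^bsub>Ext\<^esub> exterior_generator V w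
        | v w. v \<in> V \<and> w \<in> V \<and> {v, w} \<notin> E}"

lemma raag_relations_carrier: "raag_relations \<subseteq> carrier Ext"
  by (auto simp: exterior_generator_mult intro!: X_coset_carrier word_carrier)

sublocale R: algebra_ideal Ext "raag_ideal V E"
  unfolding raag_ideal_def
  by (rule genideal_algebra_ideal[OF bilinear_Ext ring_Ext raag_relations_carrier])

abbreviation A where "A \<equiv> raag_cohomology V E"

lemma A_eq: "A = R.quot"
  by (simp add: raag_cohomology_def)

lemma A_zero: "\<zero>\<^bsub>A\<^esub> = raag_ideal V E"
  by (simp add: A_eq R.quot_zero)

sublocale A: bilinear_algebra A
  unfolding A_eq by (rule R.quot_bilinear_algebra)

text \<open>All computations in \<open>A\<close> are carried out on representatives in the tensor algebra, through this
  surjection.\<close>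

definition \<pi> :: "('v list \<Rightarrow>\<^sub>0 complex) \<Rightarrow> ('v list \<Rightarrow>\<^sub>0 complex) set set" where
  "\<pi> t = R.coset (X.coset t)"

lemma carrier_A: "carrier A = \<pi> ` carrier T"
  by (auto simp: A_eq R.quot_carrier \<pi>_def) (auto simp: Ext_eq X.quot_carrier)

lemma \<pi>_carrier: "t \<in> carrier T \<Longrightarrow> \<pi> t \<in> carrier A"
  by (simp add: carrier_A)

lemma \<pi>_add: "\<lbrakk>s \<in> carrier T; t \<in> carrier T\<rbrakk> \<Longrightarrow> \<pi> (s + t) = \<pi> s \<oplus>\<^bsub>A\<^esub> \<pi> t"
  using R.quot_add[of "X.coset s" "X.coset t"] X.quot_add[of s t]
  by (simp add: \<pi>_def A_eq X_coset_carrier) (simp add: Ext_eq T_simps)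

lemma \<pi>_scale: "t \<in> carrier T \<Longrightarrow> \<pi> (scale c t) = c \<odot>\<^bsub>A\<^esub> \<pi> t"
  using R.quot_smult[of "X.coset t" c] X.quot_smult[of t c]
  by (simp add: \<pi>_def A_eq X_coset_carrier) (simp add: Ext_eq T_simps)

lemma \<pi>_mult: "\<lbrakk>s \<in> carrier T; t \<in> carrier T\<rbrakk> \<Longrightarrow> \<pi> (s \<otimes>\<^bsub>T\<^esub> t) = \<pi> s \<otimes>\<^bsub>A\<^esub> \<pi> t"
  using R.quot_mult[of "X.coset s" "X.coset t"] X.quot_mult[of s t]
  by (simp add: \<pi>_def A_eq X_coset_carrier) (simp add: Ext_eq)

lemma \<pi>_zero: "\<pi> 0 = \<zero>\<^bsub>A\<^esub>"
  using \<pi>_scale[of 0 0] \<pi>_carrier[of 0] T.M.zero_closed A.zero_smult by (simp add: T_simps(2))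

lemma zero_differential_A: "a \<in> carrier A \<Longrightarrow> differential A a = \<zero>\<^bsub>A\<^esub>"
proof -
  assume "a \<in> carrier A"
  then obtain t where t: "t \<in> carrier T" "a = R.coset (X.coset t)"
    by (auto simp: carrier_A \<pi>_def)
  have "differential Ext Y \<in> raag_ideal V E" if "Y \<in> carrier Ext" for Y
  proof -
    obtain s where s: "s \<in> carrier T" "Y = X.coset s"
      using \<open>Y \<in> carrier Ext\<close> by (auto simp: Ext_eq X.quot_carrier)
    have "differential X.quot (X.coset s) = exterior_ideal V"
      using X.ideal_zero by (intro X.quot_differential s) (simp add: T_simps)
    then show ?thesis
      using R.ideal_zero by (simp add: s Ext_eq X.quot_zero)
  qed
  then have "differential R.quot a = raag_ideal V E"
    unfolding t(2) using t(1) by (intro R.quot_differential X_coset_carrier)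
  then show ?thesis
    by (simp add: A_eq R.quot_zero)
qed

lemma grade_A: "grade A i = \<pi> ` grade T i"
  by (simp add: A_eq R.quot_grade) (simp add: Ext_eq X.quot_grade image_image \<pi>_def)

lemma grade_A_carrier: "grade A i \<subseteq> carrier A"
  using grade_T_carrier by (auto simp: grade_A intro!: \<pi>_carrier)

abbreviation gen where "gen \<equiv> raag_generator V E"

lemma gen_eq: "gen v = \<pi> (Poly_Mapping.single [v] 1)"
  by (simp add: raag_generator_def exterior_generator_eq \<pi>_def)

lemma gen_carrier: "gen \<in> V \<rightarrow> carrier A"
  by (auto simp: gen_eq intro!: \<pi>_carrier word_carrier)

lemma gen_mult: "\<lbrakk>v \<in> V; w \<in> V\<rbrakk> \<Longrightarrow> gen v \<otimes>\<^bsub>A\<^esub> gen w = \<pi> (Poly_Mapping.single [v, w] 1)"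
  using \<pi>_mult[of "Poly_Mapping.single [v] 1" "Poly_Mapping.single [w] 1"]
  by (simp add: gen_eq word_carrier) (simp add: T_simps)

lemma gen_mult_nonedge:
  assumes "v \<in> V" "w \<in> V" "{v, w} \<notin> E"
  shows "gen v \<otimes>\<^bsub>A\<^esub> gen w = \<zero>\<^bsub>A\<^esub>"
proof -
  have "X.coset (Poly_Mapping.single [v, w] 1) \<in> raag_relations"
    using assms exterior_generator_mult by blast
  then have "X.coset (Poly_Mapping.single [v, w] 1) \<in> raag_ideal V E"
    unfolding raag_ideal_def using ring.genideal_self[OF ring_Ext raag_relations_carrier] by blast
  then show ?thesis
    using assms by (simp add: gen_mult \<pi>_def R.coset_ideal A_zero)
qed

lemma grade_one_span: "grade A 1 \<subseteq> lin_span A (gen ` V)"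
proof -
  have sub: "submodule complex_field (lin_span A (gen ` V)) A"
    using gen_carrier by (intro A.span_is_submodule) auto
  have "\<pi> t \<in> lin_span A (gen ` V)" if "t \<in> grade T 1" for t
  proof -
    have "Poly_Mapping.keys t \<subseteq> {w \<in> lists V. length w = 1}"
      using that by (simp add: T_simps)
    then show ?thesis
    proof (induction t rule: formal_induct)
      case zero
      then show ?case using submodule.zero_closed[OF sub] by (simp add: \<pi>_zero)
    next
      case (single u c)
      then obtain v where v: "v \<in> V" "u = [v]" by (cases u) auto
      have "gen v \<in> lin_span A (gen ` V)"
        using v gen_carrier by (intro set_mp[OF A.in_own_span]) auto
      then show ?case
        using submodule.smult_closed[OF sub, of c] \<pi>_scale[of "Poly_Mapping.single [v] 1" c] v
        by (simp add: gen_eq word_carrier)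
    next
      case (add p q)
      then have "p \<in> carrier T" "q \<in> carrier T" by (auto simp: T_simps)
      then show ?case using add submodule.m_closed[OF sub] by (simp add: \<pi>_add)
    qed
  qed
  then show ?thesis by (auto simp: grade_A)
qed

subsection \<open>Products over edges are nonzero\<close>

text \<open>On degree two, this functional is the coefficient of \<open>v\<^sup>* w\<^sup>*\<close> in the exterior algebra.\<close>

definition alt :: "'v \<Rightarrow> 'v \<Rightarrow> ('v list \<Rightarrow>\<^sub>0 complex) \<Rightarrow> complex" where
  "alt v w t = Poly_Mapping.lookup t [v, w] - Poly_Mapping.lookup t [w, v]"

text \<open>The kernel of \<open>alt v w\<close> is in general not an ideal, as multiplying by generators moves terms of low degree into
  degree two. Once the terms of degree zero and one are excluded, the degree two part of a product is a
  scalar multiple of the degree two part of the factor that lies in the set, and an ideal results.\<close>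

definition alt_ideal :: "'v \<Rightarrow> 'v \<Rightarrow> ('v list \<Rightarrow>\<^sub>0 complex) set" where
  "alt_ideal v w = {t \<in> carrier T. Poly_Mapping.lookup t [] = 0 \<and>
    (\<forall>u. Poly_Mapping.lookup t [u] = 0) \<and> alt v w t = 0}"

lemma alt_add: "alt v w (s + t) = alt v w s + alt v w t"
  by (simp add: alt_def lookup_add)

lemma alt_scale: "alt v w (scale c t) = c * alt v w t"
  by (simp add: alt_def algebra_simps)

lemma alt_ideal: "algebra_ideal T (alt_ideal v w)"
proof (intro algebra_ideal.intro algebra_ideal_axioms.intro T.bilinear_algebra_axioms
    submodule_complexI T.module_axioms)
  show "\<zero>\<^bsub>T\<^esub> \<in> alt_ideal v w"
    by (simp add: alt_ideal_def alt_def) (simp add: T_simps)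
next
  fix x y assume "x \<in> alt_ideal v w" "y \<in> alt_ideal v w"
  then show "x \<oplus>\<^bsub>T\<^esub> y \<in> alt_ideal v w"
    using T.M.a_closed[of x y] by (simp add: alt_ideal_def alt_add lookup_add T_simps(3))
next
  fix c x assume "x \<in> alt_ideal v w"
  then show "c \<odot>\<^bsub>T\<^esub> x \<in> alt_ideal v w"
    using T.smult_carrier[of x c] by (simp add: alt_ideal_def alt_scale T_simps(4))
next
  fix x k assume x: "x \<in> carrier T" and k: "k \<in> alt_ideal v w"
  have prod: "x \<otimes>\<^bsub>T\<^esub> k \<in> carrier T" "k \<otimes>\<^bsub>T\<^esub> x \<in> carrier T"
    using x k T.mult_closed by (auto simp: alt_ideal_def)
  have low: "Poly_Mapping.lookup k [] = 0" "\<And>u. Poly_Mapping.lookup k [u] = 0"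
    and vw: "Poly_Mapping.lookup k [v, w] = Poly_Mapping.lookup k [w, v]"
    using k by (auto simp: alt_ideal_def alt_def)
  show "x \<otimes>\<^bsub>T\<^esub> k \<in> alt_ideal v w" "k \<otimes>\<^bsub>T\<^esub> x \<in> alt_ideal v w"
    using prod by (simp_all add: alt_ideal_def alt_def T_simps(5) lookup_concatenation_product low vw)
qed (auto simp: alt_ideal_def)

text \<open>For \<open>x\<close> of degree one, \<open>x \<otimes> x\<close> has the symmetric coefficients \<open>x\<^sub>v x\<^sub>w\<close> in degree two.\<close>

lemma exterior_ideal_subset: "exterior_ideal V \<subseteq> alt_ideal v w"
  unfolding exterior_ideal_def
proof (rule ring.genideal_minimal[OF ring_T algebra_ideal_imp_ideal[OF alt_ideal ring_T]], clarify)
  fix x assume x: "x \<in> grade T 1"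
  have low: "Poly_Mapping.lookup x u = 0" if "length u \<noteq> 1" for u
    using x that by (auto simp: T_simps in_keys_iff subset_iff)
  have "x \<otimes>\<^bsub>T\<^esub> x \<in> carrier T"
    using x by (intro T.mult_closed grade_T_carrier)
  then show "x \<otimes>\<^bsub>T\<^esub> x \<in> alt_ideal v w"
    by (simp add: alt_ideal_def alt_def T_simps(5) lookup_concatenation_product low)
qed

definition alt_ideal_Ext :: "'v \<Rightarrow> 'v \<Rightarrow> ('v list \<Rightarrow>\<^sub>0 complex) set set" where
  "alt_ideal_Ext v w = X.coset ` alt_ideal v w"

lemma coset_in_alt_ideal_Ext_iff:
  assumes "t \<in> carrier T"
  shows "X.coset t \<in> alt_ideal_Ext v w \<longleftrightarrow> t \<in> alt_ideal v w"
proof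
  interpret I: algebra_ideal T "alt_ideal v w" by (rule alt_ideal)
  assume "X.coset t \<in> alt_ideal_Ext v w"
  then obtain s where s: "s \<in> alt_ideal v w" "X.coset t = X.coset s"
    by (auto simp: alt_ideal_Ext_def)
  then have "t \<in> X.coset s"
    using X.a_rcos_self[OF assms] by simp
  then obtain k where "k \<in> exterior_ideal V" "t = k \<oplus>\<^bsub>T\<^esub> s"
    using s(1) by (auto elim!: X.coset_elim simp: I.ideal_carrier)
  then show "t \<in> alt_ideal v w"
    using exterior_ideal_subset s(1) I.ideal_add by blast
qed (simp add: alt_ideal_Ext_def)

lemma alt_ideal_Ext: "algebra_ideal Ext (alt_ideal_Ext v w)"
proof -
  interpret I: algebra_ideal T "alt_ideal v w" by (rule alt_ideal)
  note carr = I.ideal_carrier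
  show ?thesis
  proof (intro algebra_ideal.intro algebra_ideal_axioms.intro bilinear_Ext
      submodule_complexI bilinear_algebra.axioms(1)[OF bilinear_Ext])
    show "alt_ideal_Ext v w \<subseteq> carrier Ext"
      by (auto simp: alt_ideal_Ext_def Ext_eq intro!: X.coset_carrier carr)
    show "\<zero>\<^bsub>Ext\<^esub> \<in> alt_ideal_Ext v w"
      using X.coset_ideal[OF X.ideal_zero] I.ideal_zero
      by (auto simp: alt_ideal_Ext_def Ext_eq X.quot_zero)
  next
    fix x y assume "x \<in> alt_ideal_Ext v w" "y \<in> alt_ideal_Ext v w"
    then show "x \<oplus>\<^bsub>Ext\<^esub> y \<in> alt_ideal_Ext v w"
      by (auto simp: alt_ideal_Ext_def Ext_eq X.quot_add carr I.ideal_add)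
  next
    fix c x assume "x \<in> alt_ideal_Ext v w"
    then show "c \<odot>\<^bsub>Ext\<^esub> x \<in> alt_ideal_Ext v w"
      by (auto simp: alt_ideal_Ext_def Ext_eq X.quot_smult carr I.ideal_smult)
  next
    fix x k assume "x \<in> carrier Ext" "k \<in> alt_ideal_Ext v w"
    then show "x \<otimes>\<^bsub>Ext\<^esub> k \<in> alt_ideal_Ext v w" "k \<otimes>\<^bsub>Ext\<^esub> x \<in> alt_ideal_Ext v w"
      by (auto simp: alt_ideal_Ext_def Ext_eq X.quot_carrier X.quot_mult carr I.absorb_left I.absorb_right)
  qed
qed

text \<open>A generator \<open>v'\<^sup>* w'\<^sup>*\<close> of the ideal comes from a non-edge, so its word is neither \<open>[v, w]\<close> nor
  \<open>[w, v]\<close>.\<close>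

lemma raag_ideal_subset:
  assumes "{v, w} \<in> E"
  shows "raag_ideal V E \<subseteq> alt_ideal_Ext v w"
  unfolding raag_ideal_def
proof (rule ring.genideal_minimal[OF ring_Ext algebra_ideal_imp_ideal[OF alt_ideal_Ext ring_Ext]], clarify)
  fix v' w' assume *: "v' \<in> V" "w' \<in> V" "{v', w'} \<notin> E"
  have coeff: "Poly_Mapping.lookup (Poly_Mapping.single [v', w'] (1 :: complex)) u = 0"
    if "[v', w'] \<noteq> u" for u
    using that by (rule lookup_single_not_eq)
  have "[v', w'] \<noteq> [v, w]" "[v', w'] \<noteq> [w, v]"
    using assms *(3) by (auto simp: insert_commute)
  then have "alt v w (Poly_Mapping.single [v', w'] 1) = 0"
    by (simp add: alt_def coeff del: list.inject)
  then have "Poly_Mapping.single [v', w'] 1 \<in> alt_ideal v w"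
    unfolding alt_ideal_def using *(1,2)
    by (intro CollectI conjI allI word_carrier coeff) auto
  then show "exterior_generator V v' \<otimes>\<^bsub>Ext\<^esub> exterior_generator V w' \<in> alt_ideal_Ext v w"
    using * by (simp add: exterior_generator_mult alt_ideal_Ext_def)
qed

lemma alt_eq_if_\<pi>_eq:
  assumes E: "{v, w} \<in> E" and st: "s \<in> carrier T" "t \<in> carrier T" "\<pi> s = \<pi> t"
  shows "alt v w s = alt v w t"
proof -
  have c: "X.coset s \<in> carrier Ext" "X.coset t \<in> carrier Ext"
    using st by (auto intro: X_coset_carrier)
  have neg: "scale (-1) t \<in> carrier T"
    using T.smult_carrier[OF st(2), of "-1"] by (simp add: T_simps(4))
  have "X.coset s \<oplus>\<^bsub>Ext\<^esub> \<ominus>\<^bsub>Ext\<^esub> X.coset t \<in> raag_ideal V E"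
    using st(3) R.coset_eq_iff[OF c] by (simp add: \<pi>_def)
  also have "X.coset s \<oplus>\<^bsub>Ext\<^esub> \<ominus>\<^bsub>Ext\<^esub> X.coset t = X.coset (s + scale (-1) t)"
    using st c neg X.quot_smult[OF st(2), of "-1"] X.quot_add[OF st(1) neg]
    by (simp add: R.uminus_eq_smult) (simp add: Ext_eq T_simps(3,4))
  finally have "s + scale (-1) t \<in> alt_ideal v w"
    using raag_ideal_subset[OF E] coset_in_alt_ideal_Ext_iff T.M.a_closed[OF st(1) neg]
    by (auto simp: T_simps(3))
  then show ?thesis
    by (simp add: alt_ideal_def alt_add alt_scale)
qed

text \<open>The functional \<open>alt v w\<close> kills both ideals and thus descends to \<open>A\<close>. It shows that \<open>v\<^sup>* w\<^sup>*\<close> is nonzero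
  and independent of the products over all other edges.\<close>

lemma edge_functional:
  assumes E: "{v, w} \<in> E"
  obtains \<psi> where
    "\<And>a b. \<lbrakk>a \<in> carrier A; b \<in> carrier A\<rbrakk> \<Longrightarrow> \<psi> (a \<oplus>\<^bsub>A\<^esub> b) = \<psi> a + \<psi> b"
    "\<And>c a. a \<in> carrier A \<Longrightarrow> \<psi> (c \<odot>\<^bsub>A\<^esub> a) = c * \<psi> a"
    "\<And>v' w'. \<lbrakk>v' \<in> V; w' \<in> V\<rbrakk> \<Longrightarrow> \<psi> (gen v' \<otimes>\<^bsub>A\<^esub> gen w') =
      (if v' = v \<and> w' = w then 1 else if v' = w \<and> w' = v then -1 else 0)"
proof -
  define \<psi> where "\<psi> a = alt v w (inv_into (carrier T) \<pi> a)" for a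
  have \<psi>: "\<psi> (\<pi> t) = alt v w t" if "t \<in> carrier T" for t
    unfolding \<psi>_def using that
    by (intro alt_eq_if_\<pi>_eq[OF E] inv_into_into f_inv_into_f) auto
  show thesis
  proof (rule that[of \<psi>])
    fix a b assume "a \<in> carrier A" "b \<in> carrier A"
    then obtain s t where "s \<in> carrier T" "t \<in> carrier T" "a = \<pi> s" "b = \<pi> t"
      by (auto simp: carrier_A)
    then show "\<psi> (a \<oplus>\<^bsub>A\<^esub> b) = \<psi> a + \<psi> b"
      using T.M.a_closed[of s t] by (simp add: \<psi> alt_add T_simps(3) flip: \<pi>_add)
  next
    fix c a assume "a \<in> carrier A"
    then obtain t where "t \<in> carrier T" "a = \<pi> t"
      by (auto simp: carrier_A)
    then show "\<psi> (c \<odot>\<^bsub>A\<^esub> a) = c * \<psi> a"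
      using T.smult_carrier[of t c] by (simp add: \<psi> alt_scale T_simps(4) flip: \<pi>_scale)
  next
    fix v' w' assume *: "v' \<in> V" "w' \<in> V"
    show "\<psi> (gen v' \<otimes>\<^bsub>A\<^esub> gen w') =
      (if v' = v \<and> w' = w then 1 else if v' = w \<and> w' = v then -1 else 0)"
      using edge_distinct[OF E] \<psi>[OF word_carrier, of "[v', w']" 1] *
      by (simp add: gen_mult alt_def lookup_single when_def)
  qed
qed

end

section \<open>The flatness criterion\<close>

definition commuting_tuples :: "'v set \<Rightarrow> 'v set set \<Rightarrow> (complex, 'g) module \<Rightarrow> ('v \<Rightarrow> 'g) set" where
  "commuting_tuples V E L =
    {\<omega> \<in> V \<rightarrow>\<^sub>E carrier L. \<forall>v w. {v, w} \<in> E \<longrightarrow> \<omega> v \<otimes>\<^bsub>L\<^esub> \<omega> w = \<zero>\<^bsub>L\<^esub>}"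

lemma (in lie_algebra) bracket_antisym:
  assumes "x \<in> carrier L" "y \<in> carrier L"
  shows "y \<otimes> x = \<ominus> (x \<otimes> y)"
proof -
  have "\<zero> = (x \<oplus> y) \<otimes> (x \<oplus> y)"
    using assms by (simp add: bracket_alternating)
  also have "\<dots> = (x \<oplus> y) \<otimes> x \<oplus> (x \<oplus> y) \<otimes> y"
    using assms by (intro bracket_add_right) auto
  also have "\<dots> = x \<otimes> y \<oplus> y \<otimes> x"
    using assms by (simp add: bracket_add_left bracket_alternating bracket_closed M.a_comm)
  finally have "x \<otimes> y \<oplus> y \<otimes> x = \<zero>"
    by simp
  then show ?thesis
    using assms M.minus_equality[of "y \<otimes> x" "x \<otimes> y"] bracket_closed
    by (simp add: M.a_comm)
qed

context raag
begin

text \<open>The square of \<open>\<Sum>\<^sub>v v\<^sup>* \<otimes> \<omega>\<^sub>v\<close> is \<open>\<Sum>\<^sub>v \<Sum>\<^sub>w v\<^sup>* w\<^sup>* \<otimes> [\<omega>\<^sub>v, \<omega>\<^sub>w]\<close>. Each term vanishes if the brackets along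
  edges do, because \<open>v\<^sup>* w\<^sup>* = 0\<close> when \<open>v\<close> and \<open>w\<close> are not adjacent. Conversely, contraction with the functional
  that belongs to an edge extracts the bracket along that edge.\<close>

lemma flat_connections_eq_commuting:
  assumes L: "lie_algebra L"
  shows "flat_connections A L = connection_of_tuple V E L ` commuting_tuples V E L"
proof -
  interpret L: lie_algebra L by fact
  interpret TF: tensor_factors A L
    by unfold_locales (rule zero_differential_A)
  have conn: "connection_of_tuple V E L \<omega> = TF.T.coset (TF.tuple_tensor V gen \<omega>)"
    if "\<omega> \<in> V \<rightarrow> carrier L" for \<omega>
    unfolding connection_of_tuple_def
    using that by (intro TF.finsum_pure_tensor finite_vertices gen_carrier)
  have flat_iff: "TF.tuple_tensor V gen \<omega> \<otimes>\<^bsub>TF.F\<^esub> TF.tuple_tensor V gen \<omega> \<in> TF.K \<longleftrightarrow>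
      (\<forall>v w. {v, w} \<in> E \<longrightarrow> \<omega> v \<otimes>\<^bsub>L\<^esub> \<omega> w = \<zero>\<^bsub>L\<^esub>)"
    if \<omega>: "\<omega> \<in> V \<rightarrow> carrier L" for \<omega>
  proof
    assume comm: "\<forall>v w. {v, w} \<in> E \<longrightarrow> \<omega> v \<otimes>\<^bsub>L\<^esub> \<omega> w = \<zero>\<^bsub>L\<^esub>"
    have "Poly_Mapping.single (gen v \<otimes>\<^bsub>A\<^esub> gen w, \<omega> v \<otimes>\<^bsub>L\<^esub> \<omega> w) 1 \<in> TF.K"
      if vw: "v \<in> V" "w \<in> V" for v w
    proof (cases "{v, w} \<in> E")
      case True
      then show ?thesis
        using comm vw gen_carrier by (auto intro!: TF.relations_zero_right A.mult_closed)
    next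
      case False
      then show ?thesis
        using vw \<omega> by (auto simp: gen_mult_nonedge intro!: TF.relations_zero_left L.bracket_closed)
    qed
    then show "TF.tuple_tensor V gen \<omega> \<otimes>\<^bsub>TF.F\<^esub> TF.tuple_tensor V gen \<omega> \<in> TF.K"
      unfolding TF.tuple_tensor_mult by (intro TF.K_sum)
  next
    assume K: "TF.tuple_tensor V gen \<omega> \<otimes>\<^bsub>TF.F\<^esub> TF.tuple_tensor V gen \<omega> \<in> TF.K"
    show "\<forall>v w. {v, w} \<in> E \<longrightarrow> \<omega> v \<otimes>\<^bsub>L\<^esub> \<omega> w = \<zero>\<^bsub>L\<^esub>"
    proof (intro allI impI)
      fix v w assume E: "{v, w} \<in> E"
      note vw = edge_vertices[OF E] edge_distinct[OF E]
      have [simp]: "\<omega> u \<in> carrier L" if "u \<in> V" for u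
        using \<omega> that by auto
      have [simp]: "gen u \<in> carrier A" if "u \<in> V" for u
        using gen_carrier that by auto
      have [simp]: "c \<odot>\<^bsub>L\<^esub> (\<omega> v' \<otimes>\<^bsub>L\<^esub> \<omega> w') \<in> carrier L" if "v' \<in> V" "w' \<in> V" for c v' w'
        using that by (intro L.smult_carrier L.bracket_closed) auto
      obtain \<psi> where \<psi>: "\<And>a b. \<lbrakk>a \<in> carrier A; b \<in> carrier A\<rbrakk> \<Longrightarrow> \<psi> (a \<oplus>\<^bsub>A\<^esub> b) = \<psi> a + \<psi> b"
        "\<And>c a. a \<in> carrier A \<Longrightarrow> \<psi> (c \<odot>\<^bsub>A\<^esub> a) = c * \<psi> a"
        and gens: "\<And>v' w'. \<lbrakk>v' \<in> V; w' \<in> V\<rbrakk> \<Longrightarrow> \<psi> (gen v' \<otimes>\<^bsub>A\<^esub> gen w') =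
          (if v' = v \<and> w' = w then 1 else if v' = w \<and> w' = v then -1 else 0)"
        using edge_functional[OF E] by blast
      let ?c = "\<lambda>v' w'. \<psi> (gen v' \<otimes>\<^bsub>A\<^esub> gen w') \<odot>\<^bsub>L\<^esub> (\<omega> v' \<otimes>\<^bsub>L\<^esub> \<omega> w')"
      have zero: "?c v' w' = \<zero>\<^bsub>L\<^esub>"
        if "v' \<in> V" "w' \<in> V" "(v', w') \<noteq> (v, w)" "(v', w') \<noteq> (w, v)" for v' w'
      proof -
        have "\<not> (v' = v \<and> w' = w)" "\<not> (v' = w \<and> w' = v)"
          using that(3,4) by auto
        then have "\<psi> (gen v' \<otimes>\<^bsub>A\<^esub> gen w') = 0"
          unfolding gens[OF that(1,2)] by (simp only: if_False)
        then show ?thesis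
          using that(1,2) by (simp add: L.zero_smult L.bracket_closed)
      qed
      have single: "(\<Oplus>\<^bsub>L\<^esub>u\<in>V. f u) = f u0"
        if "u0 \<in> V" "\<And>u. u \<in> V \<Longrightarrow> u \<noteq> u0 \<Longrightarrow> f u = \<zero>\<^bsub>L\<^esub>" "f u0 \<in> carrier L" for f u0
      proof -
        have "(\<Oplus>\<^bsub>L\<^esub>u\<in>V. f u) = (\<Oplus>\<^bsub>L\<^esub>u\<in>{u0}. f u)"
          using that finite_vertices
          by (intro L.M.add.finprod_mono_neutral_cong_right) (auto, metis L.M.zero_closed)
        then show ?thesis using that by simp
      qed
      \<comment> \<open>Only the pairs \<open>(v, w)\<close> and \<open>(w, v)\<close> survive; as the coefficient and the bracket both change
        sign under the exchange, their contributions add up instead of cancelling.\<close>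
      have "\<zero>\<^bsub>L\<^esub> = TF.contraction \<psi> (TF.tuple_tensor V gen \<omega> \<otimes>\<^bsub>TF.F\<^esub> TF.tuple_tensor V gen \<omega>)"
        by (rule TF.contraction_relations[OF \<psi> K, symmetric])
      also have "\<dots> = (\<Oplus>\<^bsub>L\<^esub>v'\<in>V. \<Oplus>\<^bsub>L\<^esub>w'\<in>V. TF.contraction \<psi>
          (Poly_Mapping.single (gen v' \<otimes>\<^bsub>A\<^esub> gen w', \<omega> v' \<otimes>\<^bsub>L\<^esub> \<omega> w') 1))"
        unfolding TF.tuple_tensor_mult using finite_vertices
        by (subst TF.contraction_sum)
          (auto intro!: L.M.finsum_cong' TF.contraction_sum TF.F_sum_carrier TF.single_carrier
            TF.contraction_carrier L.M.finsum_closed A.mult_closed L.bracket_closed)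
      also have "\<dots> = (\<Oplus>\<^bsub>L\<^esub>v'\<in>V. \<Oplus>\<^bsub>L\<^esub>w'\<in>V. ?c v' w')"
        by (auto intro!: L.M.finsum_cong' L.M.finsum_closed
            simp: TF.contraction_single A.mult_closed L.bracket_closed)
      also have "\<dots> = (\<Oplus>\<^bsub>L\<^esub>v'\<in>{v, w}. \<Oplus>\<^bsub>L\<^esub>w'\<in>V. ?c v' w')"
        using vw finite_vertices
        by (intro L.M.add.finprod_mono_neutral_cong_right)
          (auto intro!: L.M.finsum_closed L.M.add.finprod_one_eqI zero)
      also have "\<dots> = (\<Oplus>\<^bsub>L\<^esub>w'\<in>V. ?c v w') \<oplus>\<^bsub>L\<^esub> (\<Oplus>\<^bsub>L\<^esub>w'\<in>V. ?c w w')"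
        using vw by (subst L.M.finsum_insert) (auto intro!: L.M.finsum_closed)
      also have "\<dots> = ?c v w \<oplus>\<^bsub>L\<^esub> ?c w v"
        using vw by (intro arg_cong2[of _ _ _ _ "add L"] single zero) auto
      also have "\<dots> = \<omega> v \<otimes>\<^bsub>L\<^esub> \<omega> w \<oplus>\<^bsub>L\<^esub> (-1) \<odot>\<^bsub>L\<^esub> ((-1) \<odot>\<^bsub>L\<^esub> (\<omega> v \<otimes>\<^bsub>L\<^esub> \<omega> w))"
        using vw L.bracket_antisym[of "\<omega> v" "\<omega> w"]
        by (auto simp: gens L.one_smult L.uminus_eq_smult L.bracket_closed)
      also have "\<dots> = 2 \<odot>\<^bsub>L\<^esub> (\<omega> v \<otimes>\<^bsub>L\<^esub> \<omega> w)"
        using vw L.smult_assoc1[of "-1" "-1" "\<omega> v \<otimes>\<^bsub>L\<^esub> \<omega> w"] L.smult_l_distr[of 1 1 "\<omega> v \<otimes>\<^bsub>L\<^esub> \<omega> w"]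
        by (simp add: L.one_smult L.bracket_closed)
      finally have two: "2 \<odot>\<^bsub>L\<^esub> (\<omega> v \<otimes>\<^bsub>L\<^esub> \<omega> w) = \<zero>\<^bsub>L\<^esub>" by simp
      have "\<omega> v \<otimes>\<^bsub>L\<^esub> \<omega> w = (1/2) \<odot>\<^bsub>L\<^esub> (2 \<odot>\<^bsub>L\<^esub> (\<omega> v \<otimes>\<^bsub>L\<^esub> \<omega> w))"
        using vw L.smult_assoc1[of "1/2" 2 "\<omega> v \<otimes>\<^bsub>L\<^esub> \<omega> w"] by (simp add: L.one_smult L.bracket_closed)
      then show "\<omega> v \<otimes>\<^bsub>L\<^esub> \<omega> w = \<zero>\<^bsub>L\<^esub>"
        by (simp add: two L.smult_zero)
    qed
  qed
  have keys_tuple: "Poly_Mapping.keys (TF.tuple_tensor V gen \<omega>) \<subseteq> grade A 1 \<times> carrier L"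
    if "\<omega> \<in> V \<rightarrow> carrier L" for \<omega>
  proof -
    have "gen v \<in> grade A 1" if "v \<in> V" for v
      unfolding gen_eq grade_A using that by (intro imageI) (auto simp: T_simps)
    then show ?thesis
      unfolding TF.tuple_tensor_def using that
      by (intro order_trans[OF keys_sum]) auto
  qed
  show ?thesis
  proof
    show "flat_connections A L \<subseteq> connection_of_tuple V E L ` commuting_tuples V E L"
    proof
      fix \<Omega> assume "\<Omega> \<in> flat_connections A L"
      then obtain p where p: "\<Omega> = TF.T.coset p" "Poly_Mapping.keys p \<subseteq> grade A 1 \<times> carrier L"
          "p \<otimes>\<^bsub>TF.F\<^esub> p \<in> TF.K"
        unfolding TF.flat_connections_eq_cosets[OF grade_A_carrier] by blast
      have pc: "p \<in> carrier TF.F"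
        unfolding TF.F_simps(1)
        by (intro CollectI order_trans[OF p(2)] Sigma_mono grade_A_carrier order_refl)
      have "Poly_Mapping.keys p \<subseteq> lin_span A (gen ` V) \<times> carrier L"
        by (intro order_trans[OF p(2)] Sigma_mono grade_one_span order_refl)
      from TF.tuple_tensor_exists[OF finite_vertices gen_carrier this]
      obtain \<omega> where \<omega>: "\<omega> \<in> V \<rightarrow> carrier L" "TF.T.coset p = TF.T.coset (TF.tuple_tensor V gen \<omega>)"
        by blast
      let ?\<omega> = "restrict \<omega> V"
      have r: "TF.tuple_tensor V gen ?\<omega> = TF.tuple_tensor V gen \<omega>"
        unfolding TF.tuple_tensor_def by (intro sum.cong) auto
      have r': "?\<omega> \<in> V \<rightarrow> carrier L"
        using \<omega> by auto
      have tc: "TF.tuple_tensor V gen ?\<omega> \<in> carrier TF.F"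
        by (intro TF.tuple_tensor_carrier gen_carrier r')
      have "TF.T.coset (TF.tuple_tensor V gen ?\<omega> \<otimes>\<^bsub>TF.F\<^esub> TF.tuple_tensor V gen ?\<omega>) =
          TF.T.coset (p \<otimes>\<^bsub>TF.F\<^esub> p)"
        using TF.T.quot_mult[OF tc tc] TF.T.quot_mult[OF pc pc] \<omega>(2) r by simp
      also have "\<dots> = TF.K"
        using p(3) by (rule TF.T.coset_ideal)
      finally have "TF.tuple_tensor V gen ?\<omega> \<otimes>\<^bsub>TF.F\<^esub> TF.tuple_tensor V gen ?\<omega> \<in> TF.K"
        using TF.T.coset_eq_ideal_iff[OF TF.F.mult_closed[OF tc tc]] by simp
      then have "?\<omega> \<in> commuting_tuples V E L"
        using flat_iff[OF r'] \<omega>(1) by (auto simp: commuting_tuples_def)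
      moreover have "\<Omega> = connection_of_tuple V E L ?\<omega>"
        using conn[OF r'] r \<omega>(2) p(1) by simp
      ultimately show "\<Omega> \<in> connection_of_tuple V E L ` commuting_tuples V E L"
        by blast
    qed
  next
    show "connection_of_tuple V E L ` commuting_tuples V E L \<subseteq> flat_connections A L"
    proof clarify
      fix \<omega> assume "\<omega> \<in> commuting_tuples V E L"
      then have \<omega>: "\<omega> \<in> V \<rightarrow> carrier L" "\<forall>v w. {v, w} \<in> E \<longrightarrow> \<omega> v \<otimes>\<^bsub>L\<^esub> \<omega> w = \<zero>\<^bsub>L\<^esub>"
        by (auto simp: commuting_tuples_def)
      show "connection_of_tuple V E L \<omega> \<in> flat_connections A L"
        unfolding TF.flat_connections_eq_cosets[OF grade_A_carrier] conn[OF \<omega>(1)]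
        using keys_tuple[OF \<omega>(1)] flat_iff[OF \<omega>(1)] \<omega>(2) by blast
    qed
  qed
qed

end

section \<open>Rank\<close>

lemma span_subspace:
  assumes "vectorspace complex_field L" "S \<subseteq> carrier L"
  shows "vectorspace complex_field (L\<lparr>carrier := lin_span L S\<rparr>)"
proof -
  interpret vectorspace complex_field L by fact
  show ?thesis
    by (intro vectorspace.intro submodule_is_module span_is_submodule assms(2) class_field.field_axioms)
qed

text \<open>The element \<open>v\<close> is taken from \<open>S\<close> so that it lies in the span whose dimension is to be bounded.\<close>

lemma rank_le_one_if_multiples:
  assumes L: "vectorspace complex_field L" and S: "S \<subseteq> carrier L" "v \<in> S"
    and mult: "\<And>s. s \<in> S \<Longrightarrow> \<exists>c. s = c \<odot>\<^bsub>L\<^esub> v"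
  shows "rank_of L S \<le> 1"
proof -
  interpret vectorspace complex_field L by fact
  interpret W: vectorspace complex_field "L\<lparr>carrier := lin_span L S\<rparr>"
    by (rule span_subspace[OF L S(1)])
  have v: "v \<in> carrier L" "v \<in> lin_span L S"
    using S in_own_span[OF S(1)] by auto
  have sub: "submodule complex_field (lin_span L {v}) L"
    using v by (intro span_is_submodule) auto
  have "v \<in> lin_span L {v}"
    using in_own_span[of "{v}"] v by auto
  then have "S \<subseteq> lin_span L {v}"
    using mult submodule.smult_closed[OF sub, of _ v] by fastforce
  then have "lin_span L {v} = lin_span L S"
    using span_is_subset[OF _ sub] span_is_subset[OF _ span_is_submodule[OF S(1)], of "{v}"] v by blast
  moreover have "lin_span (L\<lparr>carrier := lin_span L S\<rparr>) {v} = lin_span L {v}"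
    using v by (intro span_li_not_depend(1) span_is_submodule S(1)) auto
  ultimately have "W.dim \<le> 1"
    using v by (intro W.dim_le1I) auto
  then show ?thesis
    by (simp add: rank_of_def)
qed

text \<open>The dimension is the least size of a generating set of the span. Finiteness of \<open>S\<close> ensures that this
  minimum is attained: without any finite generating set, it would be an unspecified number.\<close>

lemma multiples_if_rank_le_one:
  assumes L: "vectorspace complex_field L" and S: "S \<subseteq> carrier L" "finite S"
    and rank: "rank_of L S \<le> 1"
  obtains x where "x \<in> carrier L" "\<And>s. s \<in> S \<Longrightarrow> \<exists>c. s = c \<odot>\<^bsub>L\<^esub> x"
proof -
  interpret vectorspace complex_field L by fact
  let ?W = "L\<lparr>carrier := lin_span L S\<rparr>"
  interpret W: vectorspace complex_field ?W
    by (rule span_subspace[OF L S(1)])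
  have sub: "submodule complex_field (lin_span L S) L"
    by (rule span_is_submodule[OF S(1)])
  have NL: "lin_span L S \<subseteq> carrier L"
    using submodule.subset[OF sub] .
  have span_W: "lin_span ?W A = lin_span L A" if "A \<subseteq> lin_span L S" for A
    using that by (rule span_li_not_depend(1)[OF _ sub])
  let ?P = "\<lambda>n. \<exists>A. finite A \<and> card A = n \<and> A \<subseteq> lin_span L S \<and> lin_span ?W A = lin_span L S"
  have "?P (card S)"
    using in_own_span[OF S(1)] span_W[of S] S(2) by blast
  then have "?P (LEAST n. ?P n)"
    by (rule LeastI)
  then obtain A where A: "finite A" "card A = (LEAST n. ?P n)" "A \<subseteq> lin_span L S"
      "lin_span ?W A = lin_span L S"
    by blast
  have card: "card A \<le> 1"
    using rank A(2) by (simp add: rank_of_def W.dim_def)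
  obtain x where x: "x \<in> carrier L" "A \<subseteq> {x}"
  proof (cases "A = {}")
    case True
    then show ?thesis using that[of "\<zero>\<^bsub>L\<^esub>"] by simp
  next
    case False
    then have "card A \<noteq> 0"
      using A(1) by simp
    then have "card A = 1"
      using card by linarith
    then obtain a where "A = {a}"
      by (rule card_1_singletonE)
    then show ?thesis using that[of a] A(3) NL by auto
  qed
  \<comment> \<open>The line through \<open>x\<close> contains the generating set, hence the span, hence \<open>S\<close>.\<close>
  define N where "N = {c \<odot>\<^bsub>L\<^esub> x | c. True}"
  have N: "submodule complex_field N L"
  proof (rule submodule_complexI[OF module_axioms])
    show "N \<subseteq> carrier L"
      using x by (auto simp: N_def)
    show "\<zero>\<^bsub>L\<^esub> \<in> N"
      using smult_l_null[OF x(1)] by (auto simp: N_def intro!: exI[of _ 0])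
  next
    fix y z assume "y \<in> N" "z \<in> N"
    then obtain c d where "y = c \<odot>\<^bsub>L\<^esub> x" "z = d \<odot>\<^bsub>L\<^esub> x" by (auto simp: N_def)
    then show "y \<oplus>\<^bsub>L\<^esub> z \<in> N"
      using smult_l_distr[of c d x] x by (auto simp: N_def intro!: exI[of _ "c + d"])
  next
    fix c y assume "y \<in> N"
    then obtain d where "y = d \<odot>\<^bsub>L\<^esub> x" by (auto simp: N_def)
    then show "c \<odot>\<^bsub>L\<^esub> y \<in> N"
      using smult_assoc1[of c d x] x by (auto simp: N_def intro!: exI[of _ "c * d"])
  qed
  have "x \<in> N"
    using smult_one[OF x(1)] by (auto simp: N_def intro!: exI[of _ 1])
  then have "lin_span L A \<subseteq> N"
    using x(2) by (intro span_is_subset[OF _ N]) auto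
  then have "S \<subseteq> N"
    using in_own_span[OF S(1)] A(4) span_W[OF A(3)] by auto
  then show thesis
    using that[OF x(1)] by (auto simp: N_def)
qed

section \<open>Tuples of rank at most one on components\<close>

lemma (in lie_algebra) multiples_commute:
  assumes "x \<in> carrier L"
  shows "(c \<odot> x) \<otimes> (d \<odot> x) = \<zero>"
  using assms
  by (simp add: bracket_smult_left bracket_smult_right bracket_alternating smult_carrier smult_zero)

text \<open>An edge inside \<open>W\<close> joins two vertices of one component, whose entries lie on a common line and hence
  commute; an edge that leaves \<open>W\<close> has an end where the entry is zero.\<close>

lemma S_tuples_commuting:
  assumes L: "lie_algebra L" and graph: "simplicial_graph V E" and W: "W \<subseteq> V"
  shows "S_tuples V E L W \<subseteq> commuting_tuples V E L"
proof
  interpret lie_algebra L by fact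
  fix \<omega> assume \<omega>: "\<omega> \<in> S_tuples V E L W"
  then have car: "\<omega> \<in> V \<rightarrow>\<^sub>E carrier L"
    and zero: "\<And>v. v \<in> V - W \<Longrightarrow> \<omega> v = \<zero>\<^bsub>L\<^esub>"
    and rank: "\<And>C. C \<in> connected_components W (induced_edges E W) \<Longrightarrow> rank_of L (\<omega> ` C) \<le> 1"
    by (auto simp: S_tuples_def)
  have "\<omega> v \<otimes>\<^bsub>L\<^esub> \<omega> w = \<zero>\<^bsub>L\<^esub>" if E: "{v, w} \<in> E" for v w
  proof (cases "v \<in> W \<and> w \<in> W")
    case False
    moreover have vw: "v \<in> V" "w \<in> V"
      using E graph by (auto simp: simplicial_graph_def)
    ultimately have "\<omega> v = \<zero>\<^bsub>L\<^esub> \<or> \<omega> w = \<zero>\<^bsub>L\<^esub>"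
      using zero by blast
    then show ?thesis
      using mult_zero_left[OF PiE_mem[OF car vw(2)]] mult_zero_right[OF PiE_mem[OF car vw(1)]]
      by auto
  next
    case True
    let ?R = "{(u, v). {u, v} \<in> induced_edges E W}\<^sup>*"
    let ?C = "?R `` {v}"
    have "?C \<in> connected_components W (induced_edges E W)"
      unfolding connected_components_def using True by (intro quotientI) simp
    then have "rank_of L (\<omega> ` ?C) \<le> 1" by (rule rank)
    moreover have "u \<in> W" if "(v, u) \<in> ?R" for u
      using that by (induction rule: rtrancl_induct) (use True in \<open>auto simp: induced_edges_def\<close>)
    then have "?C \<subseteq> W" by auto
    moreover from this have "finite ?C"
      using W graph by (auto simp: simplicial_graph_def intro: finite_subset)
    ultimately obtain x where x: "x \<in> carrier L" "\<And>s. s \<in> \<omega> ` ?C \<Longrightarrow> \<exists>c. s = c \<odot>\<^bsub>L\<^esub> x"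
      using W car
      by (elim multiples_if_rank_le_one[OF vectorspace_axioms, of "\<omega> ` ?C", rotated 2]) auto
    have "v \<in> ?C" "w \<in> ?C"
      using True E by (auto simp: induced_edges_def)
    then obtain c d where "\<omega> v = c \<odot>\<^bsub>L\<^esub> x" "\<omega> w = d \<odot>\<^bsub>L\<^esub> x"
      using x(2) by blast
    then show ?thesis
      using multiples_commute[OF x(1)] by simp
  qed
  then show "\<omega> \<in> commuting_tuples V E L"
    using car by (auto simp: commuting_tuples_def)
qed

text \<open>The right choice of \<open>W\<close> is the support of \<open>\<omega>\<close>. On it every entry is nonzero, so the hypothesis on
  centralizers makes neighbouring entries proportional, and proportionality spreads along paths through
  the whole component.\<close>

lemma commuting_in_S_tuples:
  assumes L: "lie_algebra L"
    and centralizer: "\<And>x y. \<lbrakk>x \<in> carrier L; y \<in> carrier L; x \<noteq> \<zero>\<^bsub>L\<^esub>; x \<otimes>\<^bsub>L\<^esub> y = \<zero>\<^bsub>L\<^esub>\<rbrakk>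
      \<Longrightarrow> \<exists>c. y = c \<odot>\<^bsub>L\<^esub> x"
    and \<omega>: "\<omega> \<in> commuting_tuples V E L"
  shows "\<omega> \<in> S_tuples V E L {v \<in> V. \<omega> v \<noteq> \<zero>\<^bsub>L\<^esub>}"
proof -
  interpret lie_algebra L by fact
  let ?W = "{v \<in> V. \<omega> v \<noteq> \<zero>\<^bsub>L\<^esub>}"
  let ?r = "{(u, v). {u, v} \<in> induced_edges E ?W}"
  have car: "\<omega> \<in> V \<rightarrow>\<^sub>E carrier L" and comm: "\<And>v w. {v, w} \<in> E \<Longrightarrow> \<omega> v \<otimes>\<^bsub>L\<^esub> \<omega> w = \<zero>\<^bsub>L\<^esub>"
    using \<omega> by (auto simp: commuting_tuples_def)
  have "rank_of L (\<omega> ` C) \<le> 1" if "C \<in> connected_components ?W (induced_edges E ?W)" for C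
  proof -
    obtain v where v: "v \<in> ?W" "C = ?r\<^sup>* `` {v}"
      using \<open>C \<in> _\<close> unfolding connected_components_def by (elim quotientE)
    have mult: "w \<in> ?W \<and> (\<exists>c. \<omega> w = c \<odot>\<^bsub>L\<^esub> \<omega> v)" if "(v, w) \<in> ?r\<^sup>*" for w
      using that
    proof (induction rule: rtrancl_induct)
      case base
      have "\<omega> v = 1 \<odot>\<^bsub>L\<^esub> \<omega> v"
        using v car by (intro one_smult[symmetric]) auto
      then show ?case using v by blast
    next
      case (step u w)
      then have uw: "{u, w} \<in> E" "w \<in> ?W" "u \<in> ?W"
        by (auto simp: induced_edges_def)
      obtain c where c: "\<omega> u = c \<odot>\<^bsub>L\<^esub> \<omega> v" using step by blast
      obtain d where d: "\<omega> w = d \<odot>\<^bsub>L\<^esub> \<omega> u"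
        using centralizer[of "\<omega> u" "\<omega> w"] comm[OF uw(1)] uw(2,3) car by auto
      have "\<omega> w = (d * c) \<odot>\<^bsub>L\<^esub> \<omega> v"
        using smult_assoc1[of d c "\<omega> v"] PiE_mem[OF car, of v] v(1) by (simp add: c d)
      then show ?case using uw by blast
    qed
    show ?thesis
    proof (rule rank_le_one_if_multiples[OF vectorspace_axioms])
      show "\<omega> ` C \<subseteq> carrier L"
      proof (rule image_subsetI)
        fix w assume "w \<in> C"
        then have "w \<in> V" using mult unfolding v(2) by blast
        then show "\<omega> w \<in> carrier L" by (rule PiE_mem[OF car])
      qed
      show "\<omega> v \<in> \<omega> ` C"
        unfolding v(2) by blast
    next
      fix s assume "s \<in> \<omega> ` C"
      then show "\<exists>c. s = c \<odot>\<^bsub>L\<^esub> \<omega> v"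
        using mult unfolding v(2) by blast
    qed
  qed
  then show ?thesis
    using car by (auto simp: S_tuples_def)
qed

section \<open>Subalgebras of \<open>sl2\<close>\<close>

lemma mat2_eqI:
  assumes "X \<in> carrier_mat 2 2" "Y \<in> carrier_mat 2 2"
    and "X $$ (0, 0) = Y $$ (0, 0)" "X $$ (0, 1) = Y $$ (0, 1)"
      "X $$ (1, 0) = Y $$ (1, 0)" "X $$ (1, 1) = Y $$ (1, 1)"
  shows "X = Y"
  using assms by (intro eq_matI) (auto simp: less_2_cases_iff)

definition bracket2 :: "complex mat \<Rightarrow> complex mat \<Rightarrow> complex mat" where
  "bracket2 X Y = X * Y - Y * X"

lemma mat2_mult_index:
  assumes "X \<in> carrier_mat 2 2" "Y \<in> carrier_mat 2 2" "i < 2" "j < 2"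
  shows "(X * Y :: complex mat) $$ (i, j) = X $$ (i, 0) * Y $$ (0, j) + X $$ (i, 1) * Y $$ (1, j)"
  using assms by (auto simp: scalar_prod_def numeral_2_eq_2)

lemma bracket2_carrier [simp]:
  "\<lbrakk>X \<in> carrier_mat 2 2; Y \<in> carrier_mat 2 2\<rbrakk> \<Longrightarrow> bracket2 X Y \<in> carrier_mat 2 2"
  by (auto simp: bracket2_def)

lemma bracket2_dim [simp]: "dim_row (bracket2 X Y) = dim_row Y" "dim_col (bracket2 X Y) = dim_col X"
  by (simp_all add: bracket2_def)

lemma bracket2_index:
  assumes X: "X \<in> carrier_mat 2 2" and Y: "Y \<in> carrier_mat 2 2" and "i < 2" "j < 2"
  shows "bracket2 X Y $$ (i, j) =
    X $$ (i, 0) * Y $$ (0, j) + X $$ (i, 1) * Y $$ (1, j)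
      - (Y $$ (i, 0) * X $$ (0, j) + Y $$ (i, 1) * X $$ (1, j))"
proof -
  have "bracket2 X Y $$ (i, j) = (X * Y) $$ (i, j) - (Y * X) $$ (i, j)"
    unfolding bracket2_def using assms by (intro index_minus_mat) auto
  then show ?thesis
    unfolding mat2_mult_index[OF X Y assms(3,4)] mat2_mult_index[OF Y X assms(3,4)] .
qed

lemma sl2_simps:
  "carrier sl2 = {X \<in> carrier_mat 2 2. X $$ (0, 0) + X $$ (1, 1) = 0}"
  "\<zero>\<^bsub>sl2\<^esub> = 0\<^sub>m 2 2" "add sl2 = (+)" "module.smult sl2 = (\<cdot>\<^sub>m)" "mult sl2 = bracket2"
  by (auto simp: sl2_def module_mat_def bracket2_def fun_eq_iff numeral_2_eq_2)

text \<open>A vector all of whose \<open>2 \<times> 2\<close> minors with a nonzero vector vanish is a multiple of it.\<close>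

lemma proportional_if_minors_vanish:
  fixes a b c d e f :: complex
  assumes "a \<noteq> 0 \<or> b \<noteq> 0 \<or> c \<noteq> 0" "b * f = e * c" "a * e = b * d" "c * d = a * f"
  shows "\<exists>k. d = k * a \<and> e = k * b \<and> f = k * c"
proof -
  have ratio: "y = u / x * v" if "x \<noteq> 0" "x * y = v * u" for x y u v :: complex
  proof -
    have "y = x * y / x" using that(1) by simp
    then show ?thesis unfolding that(2) by simp
  qed
  consider "a \<noteq> 0" | "b \<noteq> 0" | "c \<noteq> 0" using assms(1) by blast
  then show ?thesis
  proof cases
    case 1
    then show ?thesis
      using ratio[of a e b d] ratio[of a f c d] assms(3,4) by (intro exI[of _ "d / a"]) auto
  next
    case 2
    then show ?thesis
      using ratio[of b d a e] ratio[of b f c e] assms(2,3)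
      by (intro exI[of _ "e / b"]) (auto simp: mult.commute)
  next
    case 3
    then show ?thesis
      using ratio[of c d a f] ratio[of c e b f] assms(2,4)
      by (intro exI[of _ "f / c"]) (auto simp: mult.commute)
  qed
qed

text \<open>The centralizer of a nonzero element of \<open>sl2\<close> is a line, and this property passes to subalgebras; so
  \<open>sl2\<close> and \<open>sol2\<close> can be treated together.\<close>

locale sl2_subalgebra =
  fixes C :: "complex mat set"
  assumes C_sl2: "C \<subseteq> carrier sl2"
    and C_zero: "0\<^sub>m 2 2 \<in> C"
    and C_add: "\<lbrakk>X \<in> C; Y \<in> C\<rbrakk> \<Longrightarrow> X + Y \<in> C"
    and C_smult: "X \<in> C \<Longrightarrow> c \<cdot>\<^sub>m X \<in> C"
    and C_bracket: "\<lbrakk>X \<in> C; Y \<in> C\<rbrakk> \<Longrightarrow> bracket2 X Y \<in> C"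
begin

abbreviation L where "L \<equiv> sl2\<lparr>carrier := C\<rparr>"

lemma L_simps:
  "carrier L = C" "\<zero>\<^bsub>L\<^esub> = 0\<^sub>m 2 2" "add L = (+)" "module.smult L = (\<cdot>\<^sub>m)"
  "mult L = bracket2"
  by (simp_all add: sl2_simps)

lemma C_mat: "X \<in> C \<Longrightarrow> X \<in> carrier_mat 2 2"
  using C_sl2 by (auto simp: sl2_simps)

lemma C_dim [simp]: "X \<in> C \<Longrightarrow> dim_row X = 2" "X \<in> C \<Longrightarrow> dim_col X = 2"
  using C_mat by auto

lemma C_trace: "X \<in> C \<Longrightarrow> X $$ (1, 1) = - (X $$ (0, 0))"
  using C_sl2 by (auto simp: sl2_simps eq_neg_iff_add_eq_0 add.commute)

lemma lie: "lie_algebra L"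
proof -
  have ag: "abelian_group L"
  proof (rule abelian_groupI)
    fix X assume "X \<in> carrier L"
    then show "\<exists>Y\<in>carrier L. Y \<oplus>\<^bsub>L\<^esub> X = \<zero>\<^bsub>L\<^esub>"
      by (intro bexI[of _ "(-1) \<cdot>\<^sub>m X"]) (auto simp: sl2_simps C_smult intro!: eq_matI)
  qed (auto simp: sl2_simps C_add C_zero intro!: eq_matI)
  have "Module.module complex_field L"
    by (rule module_complexI[OF ag]) (auto simp: sl2_simps C_smult algebra_simps intro!: eq_matI)
  then interpret vectorspace complex_field L
    by (intro vectorspace.intro class_field.field_axioms)
  show ?thesis
  proof unfold_locales
    fix X Y Z assume c: "X \<in> carrier L" "Y \<in> carrier L" "Z \<in> carrier L"
    note m = c[simplified, THEN C_mat]
    note m = m m[THEN carrier_matD(1)] m[THEN carrier_matD(2)]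
    show "(X \<oplus>\<^bsub>L\<^esub> Y) \<otimes>\<^bsub>L\<^esub> Z = X \<otimes>\<^bsub>L\<^esub> Z \<oplus>\<^bsub>L\<^esub> Y \<otimes>\<^bsub>L\<^esub> Z"
      using m by (simp add: sl2_simps) (rule mat2_eqI; simp add: bracket2_index algebra_simps)
    show "X \<otimes>\<^bsub>L\<^esub> (Y \<oplus>\<^bsub>L\<^esub> Z) = X \<otimes>\<^bsub>L\<^esub> Y \<oplus>\<^bsub>L\<^esub> X \<otimes>\<^bsub>L\<^esub> Z"
      using m by (simp add: sl2_simps) (rule mat2_eqI; simp add: bracket2_index algebra_simps)
    show "X \<otimes>\<^bsub>L\<^esub> (Y \<otimes>\<^bsub>L\<^esub> Z) \<oplus>\<^bsub>L\<^esub> Y \<otimes>\<^bsub>L\<^esub> (Z \<otimes>\<^bsub>L\<^esub> X) \<oplus>\<^bsub>L\<^esub> Z \<otimes>\<^bsub>L\<^esub> (X \<otimes>\<^bsub>L\<^esub> Y) = \<zero>\<^bsub>L\<^esub>"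
      using m by (simp add: sl2_simps) (rule mat2_eqI; simp add: bracket2_index algebra_simps)
  next
    fix X Y :: "complex mat" and d assume c: "X \<in> carrier L" "Y \<in> carrier L"
    note m = c[simplified, THEN C_mat]
    note m = m m[THEN carrier_matD(1)] m[THEN carrier_matD(2)]
    show "X \<otimes>\<^bsub>L\<^esub> Y \<in> carrier L"
      using c by (simp add: sl2_simps C_bracket)
    show "(d \<odot>\<^bsub>L\<^esub> X) \<otimes>\<^bsub>L\<^esub> Y = d \<odot>\<^bsub>L\<^esub> (X \<otimes>\<^bsub>L\<^esub> Y)"
      using m by (simp add: sl2_simps) (rule mat2_eqI; simp add: bracket2_index algebra_simps)
    show "X \<otimes>\<^bsub>L\<^esub> (d \<odot>\<^bsub>L\<^esub> Y) = d \<odot>\<^bsub>L\<^esub> (X \<otimes>\<^bsub>L\<^esub> Y)"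
      using m by (simp add: sl2_simps) (rule mat2_eqI; simp add: bracket2_index algebra_simps)
    show "X \<otimes>\<^bsub>L\<^esub> X = \<zero>\<^bsub>L\<^esub>"
      using m by (simp add: sl2_simps) (rule mat2_eqI; simp add: bracket2_index algebra_simps)
  qed
qed

lemma centralizer:
  assumes X: "X \<in> C" and Y: "Y \<in> C" and nz: "X \<noteq> 0\<^sub>m 2 2" and comm: "bracket2 X Y = 0\<^sub>m 2 2"
  shows "\<exists>c. Y = c \<cdot>\<^sub>m X"
proof -
  note mX = C_mat[OF X] and mY = C_mat[OF Y]
  define a b c where "a = X $$ (0, 0)" and "b = X $$ (0, 1)" and "c = X $$ (1, 0)"
  define d e f where "d = Y $$ (0, 0)" and "e = Y $$ (0, 1)" and "f = Y $$ (1, 0)"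
  note defs = a_def b_def c_def d_def e_def f_def
  \<comment> \<open>Up to sign and factors of two, the entries of the commutator are the three minors of
    \<open>(a, b, c)\<close> and \<open>(d, e, f)\<close>.\<close>
  have entry: "bracket2 X Y $$ (i, j) = 0" if "i < 2" "j < 2" for i j
    using comm that by simp
  have 1: "b * f = e * c"
    using entry[of 0 0] bracket2_index[OF mX mY, of 0 0] by (simp add: defs algebra_simps)
  have 2: "a * e = b * d"
  proof -
    have "2 * (a * e) = 2 * (b * d)"
      using entry[of 0 1] bracket2_index[OF mX mY, of 0 1] C_trace[OF X] C_trace[OF Y]
      by (simp add: defs algebra_simps)
    then show ?thesis by simp
  qed
  have 3: "c * d = a * f"
  proof -
    have "2 * (c * d) = 2 * (a * f)"
      using entry[of 1 0] bracket2_index[OF mX mY, of 1 0] C_trace[OF X] C_trace[OF Y]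
      by (simp add: defs algebra_simps)
    then show ?thesis by simp
  qed
  have "a \<noteq> 0 \<or> b \<noteq> 0 \<or> c \<noteq> 0"
  proof (rule ccontr)
    assume "\<not> ?thesis"
    then have "X = 0\<^sub>m 2 2"
      using mX C_trace[OF X] by (intro mat2_eqI) (auto simp: defs)
    with nz show False ..
  qed
  then have "\<exists>k. d = k * a \<and> e = k * b \<and> f = k * c"
    using 1 2 3 by (rule proportional_if_minors_vanish)
  then obtain k where k: "d = k * a" "e = k * b" "f = k * c" by blast
  have "Y = k \<cdot>\<^sub>m X"
    using mX mY k C_trace[OF X] C_trace[OF Y] by (intro mat2_eqI) (auto simp: defs)
  then show ?thesis ..
qed

lemma commuting_tuples_eq:
  assumes "simplicial_graph V E"
  shows "commuting_tuples V E L = (\<Union>W\<in>Pow V. S_tuples V E L W)"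
proof
  show "(\<Union>W\<in>Pow V. S_tuples V E L W) \<subseteq> commuting_tuples V E L"
    using S_tuples_commuting[OF lie assms] by blast
  show "commuting_tuples V E L \<subseteq> (\<Union>W\<in>Pow V. S_tuples V E L W)"
  proof
    fix \<omega> assume \<omega>: "\<omega> \<in> commuting_tuples V E L"
    have "\<omega> \<in> S_tuples V E L {v \<in> V. \<omega> v \<noteq> \<zero>\<^bsub>L\<^esub>}"
    proof (rule commuting_in_S_tuples[OF lie _ \<omega>])
      fix X Y assume "X \<in> carrier L" "Y \<in> carrier L" "X \<noteq> \<zero>\<^bsub>L\<^esub>" "X \<otimes>\<^bsub>L\<^esub> Y = \<zero>\<^bsub>L\<^esub>"
      then show "\<exists>c. Y = c \<odot>\<^bsub>L\<^esub> X"
        unfolding L_simps by (rule centralizer)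
    qed
    then show "\<omega> \<in> (\<Union>W\<in>Pow V. S_tuples V E L W)"
      by (rule UN_I[rotated]) simp
  qed
qed

lemma flat_connections_subalgebra:
  assumes "simplicial_graph V E"
  shows "flat_connections (raag_cohomology V E) L = (\<Union>W\<in>Pow V. S_set V E L W)"
  unfolding raag.flat_connections_eq_commuting[OF raag.intro[OF assms] lie] commuting_tuples_eq[OF assms]
    S_set_def image_UN ..

end

lemma sl2_subalgebra_sl2: "sl2_subalgebra (carrier sl2)"
  by unfold_locales
    (auto simp: sl2_simps bracket2_index algebra_simps simp flip: distrib_left)

lemma sl2_subalgebra_sol2: "sl2_subalgebra (carrier sol2)"
proof -
  interpret sl2_subalgebra "carrier sl2" by (rule sl2_subalgebra_sl2)
  have sol2: "carrier sol2 = {X \<in> carrier sl2. X $$ (1, 0) = 0}"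
    by (auto simp: sol2_def sl2_simps upper_triangular_def less_2_cases_iff)
  show ?thesis
    unfolding sol2
    by unfold_locales
      (auto simp: C_zero C_add C_smult C_bracket, auto simp: sl2_simps bracket2_index)
qed

theorem proposition6p2:
  fixes V :: "'v set" and E :: "'v set set" and L :: "(complex, 'g) module"
  assumes "simplicial_graph V E"
  shows "(lie_algebra L \<longrightarrow>
           (\<Union>W\<in>Pow V. S_set V E L W) \<subseteq> flat_connections (raag_cohomology V E) L) \<and>
         flat_connections (raag_cohomology V E) sl2 = (\<Union>W\<in>Pow V. S_set V E sl2 W) \<and>
         flat_connections (raag_cohomology V E) sol2 = (\<Union>W\<in>Pow V. S_set V E sol2 W)"
proof -
  have "(\<Union>W\<in>Pow V. S_set V E L W) \<subseteq> flat_connections (raag_cohomology V E) L"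
    if "lie_algebra L"
    unfolding raag.flat_connections_eq_commuting[OF raag.intro[OF assms] that] S_set_def
    using S_tuples_commuting[OF that assms] by blast
  moreover have "sl2\<lparr>carrier := carrier sl2\<rparr> = sl2" "sl2\<lparr>carrier := carrier sol2\<rparr> = sol2"
    by (simp_all add: sol2_def)
  ultimately show ?thesis
    using sl2_subalgebra.flat_connections_subalgebra[OF sl2_subalgebra_sl2 assms]
      sl2_subalgebra.flat_connections_subalgebra[OF sl2_subalgebra_sol2 assms]
    by simp
qed

end
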